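(* Let $\nu$ be a bounded multiplicative arithmetic function whose support has positive asymptotic density. Let $f,g$ be arithmetic functions with $g=f*\nu$. If $\sum_{n=1}^\infty |f(n)|/n<\infty$, then $|g|$ possesses a finite mean value. Moreover, if $f$ is not identically zero and $\inf_{n\in\mathrm{supp}(\nu)}|\nu(n)|>0$, then the mean value of $|g|$ is positive.
   Context: An arithmetic function is a function $\mathbb{N}\to\mathbb{C}$ ($\mathbb{N}$ the positive integers). The Dirichlet convolution is $(f*g)(n)=\sum_{d\mid n} f(d)\,g(n/d)$. $\mathrm{supp}(h)$ is the set of $n$ with $h(n)\neq0$. Asymptotic density of $\mathcal{A}\subseteq\mathbb{N}$ is $\lim_{x\to\infty}\#(\mathcal{A}\cap[1,x])/x$. The mean value of an arithmetic function $h$ is $\lim_{x\to\infty}\frac1x\sum_{n\le x}h(n)$, when it exists. *)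

theory Defs
  imports Complex_Main
begin

text \<open>Arithmetic functions are modelled as functions on \<^typ>\<open>nat\<close>; the value at \<open>0\<close> is
  irrelevant and is never inspected by the definitions below.\<close>

definition arith_multiplicative :: "(nat \<Rightarrow> complex) \<Rightarrow> bool" where
  "arith_multiplicative h \<longleftrightarrow>
     h 1 = 1 \<and> (\<forall>m>0. \<forall>n>0. coprime m n \<longrightarrow> h (m * n) = h m * h n)"

definition arith_bounded :: "(nat \<Rightarrow> complex) \<Rightarrow> bool" where
  "arith_bounded h \<longleftrightarrow> (\<exists>B::real. \<forall>n>0. norm (h n) \<le> B)"

definition dirichlet_conv :: "(nat \<Rightarrow> complex) \<Rightarrow> (nat \<Rightarrow> complex) \<Rightarrow> nat \<Rightarrow> complex" where
  "dirichlet_conv f g n = (\<Sum>d | d dvd n. f d * g (n div d))"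

definition arith_supp :: "(nat \<Rightarrow> complex) \<Rightarrow> nat set" where
  "arith_supp h = {n. n > 0 \<and> h n \<noteq> 0}"

definition has_asymp_density :: "nat set \<Rightarrow> real \<Rightarrow> bool" where
  "has_asymp_density A \<delta> \<longleftrightarrow>
     ((\<lambda>x::real. real (card {n \<in> A. 1 \<le> n \<and> real n \<le> x}) / x) \<longlongrightarrow> \<delta>) at_top"

definition has_mean_value :: "(nat \<Rightarrow> 'a::real_normed_vector) \<Rightarrow> 'a \<Rightarrow> bool" where
  "has_mean_value h m \<longleftrightarrow>
     ((\<lambda>x::real. (1 / x) *\<^sub>R (\<Sum>n | 1 \<le> n \<and> real n \<le> x. h n)) \<longlongrightarrow> m) at_top"

end

theory Submission
  imports Defs "HOL-Computational_Algebra.Primes"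
begin

text \<open>
  Existence. If \<open>\<Sum>\<^sub>p max 0 (1 - |\<nu> p|) / p\<close> diverges, then \<open>|\<nu> n|\<close> is at most a constant times the
  product of the \<open>|\<nu> p| < 1\<close> over the primes \<open>p \<le> N\<close> dividing \<open>n\<close> exactly once. That product has mean
  value \<open>\<Prod>\<^sub>p (1 - (1 - |\<nu> p|) (1/p - 1/p\<^sup>2))\<close>, which tends to \<open>0\<close>, so \<open>|\<nu>|\<close> and hence \<open>|g|\<close> have
  mean value \<open>0\<close>. If the series converges, then so does \<open>\<Sum>\<^sub>p ||\<nu> p| - 1| / p\<close>, because boundedness
  of \<open>\<nu>\<close> bounds the excess of \<open>|\<nu> p|\<close> over \<open>1\<close>. Up to a small mean error \<open>f\<close> is supported on \<open>[1, y]\<close>.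
  Write \<open>n = a b\<close>, where \<open>a\<close> collects the exact prime power divisors of \<open>n\<close> of size at most \<open>Y\<close>; for
  most \<open>n\<close> then \<open>g n = g a * \<nu> b\<close> with \<open>|\<nu> b|\<close> close to \<open>1\<close> in mean. So \<open>|g|\<close> is approximated in mean
  by the periodic functions \<open>n \<mapsto> |g a|\<close>.

  Positivity. Let \<open>d\<close> be the least element of the support of \<open>f\<close>. For \<open>b\<close> in the support of \<open>\<nu>\<close> without
  prime factors up to \<open>z\<close>, \<open>g (d b)\<close> equals \<open>f d * \<nu> b\<close> up to the terms \<open>f D\<close> with \<open>D > z\<close>. These \<open>b\<close>
  have upper density at least \<open>\<phi> \<delta>\<close>, where \<open>\<phi>\<close> is the density of all integers without prime factors
  up to \<open>z\<close>, while the error has upper mean at most a constant times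
  \<open>\<phi> \<Sum>\<^sub>D\<^sub>>\<^sub>z |f D| / D\<close>. For large \<open>z\<close> the main term wins.
\<close>

section \<open>Averages of arithmetic functions\<close>

text \<open>Integer cutoffs are enough: between consecutive integers only the divisor
  \<open>x\<close> of the average changes. The passage to \<open>has_mean_value\<close> is made
  once, at the end.\<close>

definition avg_tendsto :: "(nat \<Rightarrow> real) \<Rightarrow> real \<Rightarrow> bool" where
  "avg_tendsto u m \<longleftrightarrow> (\<lambda>k. (\<Sum>n=1..k. u n) / real k) \<longlonglongrightarrow> m"

text \<open>Expresses that the limsup of the averages is at most \<open>c\<close>, in a form without
  division by \<open>k\<close>.\<close>

definition avg_le :: "(nat \<Rightarrow> real) \<Rightarrow> real \<Rightarrow> bool" where
  "avg_le u c \<longleftrightarrow> (\<forall>e>0. \<forall>\<^sub>F k in sequentially. (\<Sum>n=1..k. u n) \<le> (c + e) * real k)"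

text \<open>For positive \<open>d\<close> this is the Dirichlet convolution of \<open>u\<close> with
  the point mass at \<open>d\<close>; divisor sums become combinations of dilates.\<close>

definition dilate :: "nat \<Rightarrow> (nat \<Rightarrow> real) \<Rightarrow> nat \<Rightarrow> real" where
  "dilate d u n = (if d dvd n then u (n div d) else 0)"

lemma avg_leD: "avg_le u c \<Longrightarrow> e > 0 \<Longrightarrow> \<forall>\<^sub>F k in sequentially. (\<Sum>n=1..k. u n) \<le> (c + e) * real k"
  by (simp add: avg_le_def)

lemma avg_le_mono:
  assumes "avg_le v c" and "\<And>n. n > 0 \<Longrightarrow> u n \<le> v n" and "c \<le> d"
  shows "avg_le u d"
  unfolding avg_le_def
proof (intro allI impI)
  fix e :: real assume "e > 0"
  show "\<forall>\<^sub>F k in sequentially. (\<Sum>n=1..k. u n) \<le> (d + e) * real k"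
    using avg_leD[OF assms(1) \<open>e > 0\<close>]
  proof eventually_elim
    case (elim k)
    have "(\<Sum>n=1..k. u n) \<le> (\<Sum>n=1..k. v n)"
      by (intro sum_mono assms(2)) auto
    also have "\<dots> \<le> (c + e) * real k" by (rule elim)
    also have "\<dots> \<le> (d + e) * real k"
      using assms(3) by (intro mult_right_mono) auto
    finally show ?case .
  qed
qed

lemma avg_le_add:
  assumes "avg_le u a" and "avg_le v b"
  shows "avg_le (\<lambda>n. u n + v n) (a + b)"
  unfolding avg_le_def
proof (intro allI impI)
  fix e :: real assume "e > 0"
  then have e: "e / 2 > 0" by simp
  show "\<forall>\<^sub>F k in sequentially. (\<Sum>n=1..k. u n + v n) \<le> (a + b + e) * real k"
    using avg_leD[OF assms(1) e] avg_leD[OF assms(2) e]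
    by eventually_elim (simp add: sum.distrib algebra_simps)
qed

lemma avg_le_0: "avg_le (\<lambda>_. 0) 0"
  by (simp add: avg_le_def)

lemma avg_le_cmult:
  assumes "avg_le u c" and "0 \<le> a"
  shows "avg_le (\<lambda>n. a * u n) (a * c)"
proof (cases "a = 0")
  case True
  then show ?thesis by (simp add: avg_le_0)
next
  case False
  with assms have a: "a > 0" by simp
  show ?thesis
    unfolding avg_le_def
  proof (intro allI impI)
    fix e :: real assume "e > 0"
    then have e: "e / a > 0" using a by simp
    show "\<forall>\<^sub>F k in sequentially. (\<Sum>n=1..k. a * u n) \<le> (a * c + e) * real k"
      using avg_leD[OF assms(1) e]
    proof eventually_elim
      case (elim k)
      have "(\<Sum>n=1..k. a * u n) = a * (\<Sum>n=1..k. u n)" by (simp add: sum_distrib_left)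
      also have "\<dots> \<le> a * ((c + e / a) * real k)" using elim a by (intro mult_left_mono) auto
      also have "\<dots> = (a * c + e) * real k" using a by (simp add: field_simps)
      finally show ?case .
    qed
  qed
qed

lemma avg_le_sum:
  assumes "\<And>i. i \<in> I \<Longrightarrow> avg_le (u i) (c i)"
  shows "avg_le (\<lambda>n. \<Sum>i\<in>I. u i n) (\<Sum>i\<in>I. c i)"
  using assms
proof (induction I rule: infinite_finite_induct)
  case (insert i I)
  then have "avg_le (\<lambda>n. u i n + (\<Sum>i\<in>I. u i n)) (c i + (\<Sum>i\<in>I. c i))"
    by (intro avg_le_add) auto
  with insert show ?case by simp
qed (auto simp: avg_le_0)

lemma avg_le_limit:
  assumes "\<And>e. e > 0 \<Longrightarrow> avg_le u (c + e)"
  shows "avg_le u c"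
  unfolding avg_le_def
proof (intro allI impI)
  fix e :: real assume "e > 0"
  then have e: "e / 2 > 0" by simp
  from avg_leD[OF assms[OF e] e]
  show "\<forall>\<^sub>F k in sequentially. (\<Sum>n=1..k. u n) \<le> (c + e) * real k" by (simp add: add.assoc)
qed

lemma avg_leI_bound:
  assumes "\<And>k. (\<Sum>n=1..k. u n) \<le> c * real k"
  shows "avg_le u c"
proof -
  have "(\<Sum>n=1..k. u n) \<le> (c + e) * real k" if "e > 0" for e k
  proof -
    have "0 \<le> e * real k" using that by simp
    with assms[of k] show ?thesis unfolding distrib_right by linarith
  qed
  then show ?thesis by (simp add: avg_le_def)
qed

lemma avg_tendsto_imp_le:
  assumes "avg_tendsto u m"
  shows "avg_le u m"
  unfolding avg_le_def
proof (intro allI impI)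
  fix e :: real assume "e > 0"
  then have "\<forall>\<^sub>F k in sequentially. (\<Sum>n=1..k. u n) / real k < m + e"
    using assms unfolding avg_tendsto_def by (intro order_tendstoD) auto
  then show "\<forall>\<^sub>F k in sequentially. (\<Sum>n=1..k. u n) \<le> (m + e) * real k"
    using eventually_gt_at_top[of 0]
    by eventually_elim (simp add: field_simps)
qed

lemma avg_tendsto_le:
  assumes "avg_tendsto u m" and "avg_le u c"
  shows "m \<le> c"
proof (rule field_le_epsilon)
  fix e :: real assume "e > 0"
  have "\<forall>\<^sub>F k in sequentially. (\<Sum>n=1..k. u n) / real k \<le> c + e"
    using avg_leD[OF assms(2) \<open>e > 0\<close>] eventually_gt_at_top[of 0]
    by eventually_elim (simp add: field_simps)
  with assms(1) show "m \<le> c + e"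
    unfolding avg_tendsto_def by (intro tendsto_upperbound) auto
qed

lemma avg_tendsto_mult_left:
  assumes "avg_tendsto u m"
  shows "avg_tendsto (\<lambda>n. a * u n) (a * m)"
  using tendsto_mult_left[OF assms[unfolded avg_tendsto_def], of a]
  by (simp add: avg_tendsto_def sum_distrib_left)

lemma avg_tendsto_add:
  assumes "avg_tendsto u a" and "avg_tendsto v b"
  shows "avg_tendsto (\<lambda>n. u n + v n) (a + b)"
  using tendsto_add[OF assms[unfolded avg_tendsto_def]]
  by (simp add: avg_tendsto_def sum.distrib add_divide_distrib)

lemma avg_tendsto_sum:
  assumes "\<And>i. i \<in> I \<Longrightarrow> avg_tendsto (u i) (c i)"
  shows "avg_tendsto (\<lambda>n. \<Sum>i\<in>I. u i n) (\<Sum>i\<in>I. c i)"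
  using assms
proof (induction I rule: infinite_finite_induct)
  case (insert i I)
  then have "avg_tendsto (\<lambda>n. u i n + (\<Sum>i\<in>I. u i n)) (c i + (\<Sum>i\<in>I. c i))"
    by (intro avg_tendsto_add) auto
  with insert show ?case by simp
qed (auto simp: avg_tendsto_def)

lemma avg_tendsto_1: "avg_tendsto (\<lambda>_. 1) 1"
  unfolding avg_tendsto_def
proof (rule tendsto_eventually)
  show "\<forall>\<^sub>F k in sequentially. (\<Sum>n=1..k. 1) / real k = (1::real)"
    using eventually_gt_at_top[of 0] by eventually_elim simp
qed

lemma avg_tendsto_cong:
  assumes "avg_tendsto u m" and "\<And>n. n > 0 \<Longrightarrow> u n = v n"
  shows "avg_tendsto v m"
proof -
  have "(\<Sum>n=1..k. u n) = (\<Sum>n=1..k. v n)" for k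
    by (intro sum.cong assms(2)) auto
  then show ?thesis using assms(1) by (simp add: avg_tendsto_def)
qed

section \<open>Averages along multiples of a fixed integer\<close>

lemma sum_dilate:
  assumes "d > 0"
  shows "(\<Sum>n=1..k. dilate d u n) = (\<Sum>m=1..k div d. u m)"
proof -
  have "(\<Sum>n=1..k. dilate d u n) = (\<Sum>n\<in>{n\<in>{1..k}. d dvd n}. u (n div d))"
    unfolding dilate_def by (subst sum.inter_filter) auto
  also have "\<dots> = (\<Sum>m=1..k div d. u m)"
    using assms
    by (intro sum.reindex_bij_witness[where i = "\<lambda>m. m * d" and j = "\<lambda>n. n div d"])
       (auto simp: div_le_mono less_eq_div_iff_mult_less_eq dvd_imp_le Suc_le_eq
             elim!: dvdE)
  finally show ?thesis .
qed

lemma filterlim_div_at_top: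
  assumes "d > (0::nat)"
  shows "filterlim (\<lambda>k. k div d) at_top at_top"
  unfolding filterlim_at_top
proof
  fix Z
  show "\<forall>\<^sub>F k in at_top. Z \<le> k div d"
    using eventually_ge_at_top[of "Z * d"]
    by eventually_elim (simp add: less_eq_div_iff_mult_less_eq assms)
qed

lemma avg_le_dilate:
  assumes "avg_le u c" and "c \<ge> 0" and "d > 0"
  shows "avg_le (dilate d u) (c / real d)"
  unfolding avg_le_def
proof (intro allI impI)
  fix e :: real assume "e > 0"
  then have e: "e * real d > 0" using assms by simp
  have "\<forall>\<^sub>F k in sequentially. (\<Sum>n=1..k div d. u n) \<le> (c + e * real d) * real (k div d)"
    using avg_leD[OF assms(1) e] filterlim_div_at_top[OF assms(3)]
    unfolding filterlim_iff by blast
  then show "\<forall>\<^sub>F k in sequentially. (\<Sum>n=1..k. dilate d u n) \<le> (c / real d + e) * real k"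
  proof eventually_elim
    case (elim k)
    \<comment> \<open>Rounding \<open>k / d\<close> down can only help, because
      \<open>c \<ge> 0\<close> makes the factor in front nonnegative.\<close>
    have "real (k div d) \<le> real k / real d"
      by (rule of_nat_div_le_of_nat)
    then have "(c + e * real d) * real (k div d) \<le> (c + e * real d) * (real k / real d)"
      using assms(2) e by (intro mult_left_mono) auto
    also have "\<dots> = (c / real d + e) * real k" using assms(3) by (simp add: field_simps)
    finally show ?case using elim by (subst sum_dilate[OF assms(3)]) linarith
  qed
qed

lemma avg_tendsto_dilate:
  assumes "avg_tendsto u m" and "d > 0"
  shows "avg_tendsto (dilate d u) (m / real d)"
proof -
  have 1: "(\<lambda>k. (\<Sum>n=1..k div d. u n) / real (k div d)) \<longlonglongrightarrow> m"
    using filterlim_compose[OF assms(1)[unfolded avg_tendsto_def] filterlim_div_at_top[OF assms(2)]] .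
  have 2: "(\<lambda>k. real (k div d) / real k) \<longlonglongrightarrow> 1 / real d"
  proof (rule tendsto_sandwich)
    show "\<forall>\<^sub>F k in sequentially. 1 / real d - 1 / real k \<le> real (k div d) / real k"
      using eventually_gt_at_top[of 0]
    proof eventually_elim
      case (elim k)
      have "real k / real d - 1 \<le> real (k div d)"
        using floor_divide_of_nat_eq[of k d, where 'a = real] by linarith
      then have "(real k / real d - 1) / real k \<le> real (k div d) / real k"
        by (intro divide_right_mono) auto
      then show ?case using elim by (simp add: diff_divide_distrib)
    qed
    show "\<forall>\<^sub>F k in sequentially. real (k div d) / real k \<le> 1 / real d"
      using eventually_gt_at_top[of 0]
    proof eventually_elim
      case (elim k)
      have "real (k div d) \<le> real k / real d"
        by (rule of_nat_div_le_of_nat)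
      then have "real (k div d) / real k \<le> (real k / real d) / real k"
        by (intro divide_right_mono) auto
      then show ?case using elim by simp
    qed
    show "(\<lambda>k. 1 / real d - 1 / real k) \<longlonglongrightarrow> 1 / real d"
      using tendsto_diff[OF tendsto_const lim_1_over_n] by force
  qed simp
  have "(\<lambda>k. (real (k div d) / real k) * ((\<Sum>n=1..k div d. u n) / real (k div d))) \<longlonglongrightarrow> 1 / real d * m"
    by (rule tendsto_mult[OF 2 1])
  moreover have "(real (k div d) / real k) * ((\<Sum>n=1..k div d. u n) / real (k div d))
      = (\<Sum>n=1..k. dilate d u n) / real k" for k
    by (subst sum_dilate[OF assms(2)]) auto
  ultimately show ?thesis by (simp add: avg_tendsto_def)
qed

text \<open>The multiples of \<open>d\<close> up to \<open>d * k\<close> are among all integers up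
  to \<open>d * k\<close>. Nonnegativity allows the other terms to be added, at the price of the
  factor \<open>d\<close>.\<close>

lemma avg_le_multiples:
  assumes "avg_le u c" and "d > 0" and "\<And>n. u n \<ge> 0"
  shows "avg_le (\<lambda>b. u (d * b)) (real d * c)"
  unfolding avg_le_def
proof (intro allI impI)
  fix e :: real assume "e > 0"
  then have "e / real d > 0" using assms by simp
  moreover have "filterlim (\<lambda>k. d * k) at_top sequentially"
    using assms(2) by (simp add: mult_nat_left_at_top)
  ultimately have "\<forall>\<^sub>F k in sequentially. (\<Sum>n=1..d * k. u n) \<le> (c + e / real d) * real (d * k)"
    using avg_leD[OF assms(1)] unfolding filterlim_iff by blast
  then show "\<forall>\<^sub>F k in sequentially. (\<Sum>b=1..k. u (d * b)) \<le> (real d * c + e) * real k"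
  proof eventually_elim
    case (elim k)
    have "(\<Sum>b=1..k. u (d * b)) = (\<Sum>n\<in>(\<lambda>b. d * b) ` {1..k}. u n)"
      using assms(2) by (subst sum.reindex) (auto simp: inj_on_def)
    also have "\<dots> \<le> (\<Sum>n=1..d * k. u n)"
      using assms by (intro sum_mono2) (auto simp: Suc_le_eq)
    also note elim
    also have "(c + e / real d) * real (d * k) = (real d * c + e) * real k"
      using assms(2) by (simp add: field_simps)
    finally show ?case .
  qed
qed

section \<open>Divisor sums restricted to large divisors\<close>

lemma sum_divisors_dilate:
  assumes "n > 0" and "n \<le> k"
  shows "(\<Sum>d | d dvd n \<and> d > Y. F d * u (n div d)) = (\<Sum>d\<in>{Y<..k}. F d * dilate d u n)"
proof -
  have "{d. d dvd n \<and> d > Y} = {d \<in> {Y<..k}. d dvd n}"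
    using assms by (auto dest: dvd_imp_le)
  then have "(\<Sum>d | d dvd n \<and> d > Y. F d * u (n div d)) = (\<Sum>d\<in>{d \<in> {Y<..k}. d dvd n}. F d * u (n div d))"
    by simp
  also have "\<dots> = (\<Sum>d\<in>{Y<..k}. if d dvd n then F d * u (n div d) else 0)"
    by (rule sum.inter_filter) simp
  also have "\<dots> = (\<Sum>d\<in>{Y<..k}. F d * dilate d u n)"
    by (intro sum.cong) (auto simp: dilate_def)
  finally show ?thesis .
qed

text \<open>After interchanging the sums, each \<open>d\<close> contributes at most
  \<open>k / d\<close> multiples. The estimate holds for every \<open>k\<close>, so infinitely many
  \<open>d\<close> are treated at once, which finite sums of \<open>avg_le\<close> statements cannot
  do.\<close>

lemma sum_tail_divisors_le:
  fixes F :: "nat \<Rightarrow> real"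
  assumes "\<And>d. F d \<ge> 0"
  shows "(\<Sum>n=1..k. \<Sum>d | d dvd n \<and> d > Y. F d) \<le> (\<Sum>d\<in>{Y<..k}. F d / real d) * real k"
proof -
  have "(\<Sum>n=1..k. \<Sum>d | d dvd n \<and> d > Y. F d) = (\<Sum>n=1..k. \<Sum>d\<in>{Y<..k}. F d * dilate d (\<lambda>_. 1) n)"
    using sum_divisors_dilate[where u = "\<lambda>_. 1" and F = F] by (intro sum.cong[OF refl]) simp
  also have "\<dots> = (\<Sum>d\<in>{Y<..k}. F d * (\<Sum>n=1..k. dilate d (\<lambda>_. 1) n))"
    by (subst sum.swap) (simp add: sum_distrib_left)
  also have "\<dots> \<le> (\<Sum>d\<in>{Y<..k}. F d * (real k / real d))"
  proof (intro sum_mono mult_left_mono assms)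
    fix d assume "d \<in> {Y<..k}"
    then have "(\<Sum>n=1..k. dilate d (\<lambda>_. 1) n) = real (k div d)"
      by (subst sum_dilate) auto
    then show "(\<Sum>n=1..k. dilate d (\<lambda>_. 1) n) \<le> real k / real d"
      by (simp add: of_nat_div_le_of_nat)
  qed
  finally show ?thesis by (simp add: sum_distrib_right)
qed

lemma avg_le_tail_divisors:
  fixes F :: "nat \<Rightarrow> real"
  assumes "\<And>d. F d \<ge> 0" and "\<And>k. (\<Sum>d\<in>{Y<..k}. F d / real d) \<le> c"
  shows "avg_le (\<lambda>n. \<Sum>d | d dvd n \<and> d > Y. F d) c"
proof (rule avg_leI_bound)
  fix k
  show "(\<Sum>n=1..k. \<Sum>d | d dvd n \<and> d > Y. F d) \<le> c * real k"
    using sum_tail_divisors_le[where F = F and Y = Y and k = k, OF assms(1)] mult_right_mono[OF assms(2)[of k], of "real k"]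
    by linarith
qed

lemma summable_tail_small:
  fixes a :: "nat \<Rightarrow> real"
  assumes "summable a" and "e > 0"
  shows "\<exists>Y0. \<forall>Y\<ge>Y0. \<forall>k. (\<Sum>d\<in>{Y<..k}. a d) \<le> e"
proof -
  obtain N where N: "\<And>m n. m \<ge> N \<Longrightarrow> norm (sum a {m..<n}) < e"
    using assms by (meson summable_Cauchy)
  have "(\<Sum>d\<in>{Y<..k}. a d) \<le> e" if "Y \<ge> N" for Y k
  proof -
    have "{Y<..k} = {Suc Y..<Suc k}" by auto
    then show ?thesis using N[of "Suc Y" "Suc k"] that by (smt (verit) le_SucI real_norm_def)
  qed
  then show ?thesis by blast
qed

text \<open>The difference \<open>U k\<close> between the partial sum and \<open>m * k\<close> is
  itself periodic, hence bounded, and vanishes after division by \<open>k\<close>.\<close>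

lemma avg_tendsto_periodic:
  assumes N: "N > 0" and per: "\<And>n. n > 0 \<Longrightarrow> u (n + N) = u n"
  shows "avg_tendsto u ((\<Sum>n=1..N. u n) / real N)"
proof -
  define m where "m = (\<Sum>n=1..N. u n) / real N"
  define U where "U k = (\<Sum>n=1..k. u n) - m * real k" for k
  have UN: "U (k + N) = U k" for k
  proof (induction k)
    case 0
    show ?case using N by (simp add: U_def m_def)
  next
    case (Suc k)
    have "U (Suc k + N) = U (k + N) + u (Suc k + N) - m" by (simp add: U_def algebra_simps)
    also have "\<dots> = U (Suc k)" using per[of "Suc k"] Suc by (simp add: U_def algebra_simps)
    finally show ?case .
  qed
  have Umod: "U k = U (k mod N)" for k
  proof (induction k rule: less_induct)
    case (less k)
    show ?case
    proof (cases "k < N")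
      case False
      then have "U k = U (k - N)" using UN[of "k - N"] by simp
      also have "\<dots> = U ((k - N) mod N)" using False N by (intro less) auto
      finally show ?thesis using False by (simp add: le_mod_geq)
    qed simp
  qed
  define C where "C = (\<Sum>i<N. \<bar>U i\<bar>)"
  have C: "\<bar>U k\<bar> \<le> C" for k
  proof -
    have "k mod N < N" using N by simp
    then have "\<bar>U (k mod N)\<bar> \<le> C" unfolding C_def by (intro member_le_sum) auto
    then show ?thesis using Umod by simp
  qed
  have "(\<lambda>k. U k / real k) \<longlonglongrightarrow> 0"
  proof (rule tendsto_0_le[OF lim_1_over_n])
    show "\<forall>\<^sub>F k in sequentially. norm (U k / real k) \<le> norm (1 / real k) * C"
      using C by (intro always_eventually allI) (auto simp: abs_divide intro: divide_right_mono)
  qed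
  then have "(\<lambda>k. U k / real k + m) \<longlonglongrightarrow> 0 + m" by (intro tendsto_add tendsto_const)
  moreover have "\<forall>\<^sub>F k in sequentially. U k / real k + m = (\<Sum>n=1..k. u n) / real k"
    using eventually_gt_at_top[of 0] by eventually_elim (simp add: U_def field_simps)
  ultimately have "avg_tendsto u m"
    unfolding avg_tendsto_def using Lim_transform_eventually by force
  then show ?thesis by (simp add: m_def)
qed

text \<open>Functions with a mean value are closed under approximation in upper mean: the averages
  form a Cauchy sequence. No candidate for the limit is needed.\<close>

lemma avg_tendsto_approx:
  assumes "\<And>e. e > 0 \<Longrightarrow> \<exists>v m. avg_tendsto v m \<and> avg_le (\<lambda>n. \<bar>u n - v n\<bar>) e"
  shows "\<exists>m. avg_tendsto u m"
proof -
  let ?U = "\<lambda>k. (\<Sum>n=1..k. u n) / real k"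
  have "Cauchy ?U"
  proof (rule metric_CauchyI)
    fix e :: real assume "e > 0"
    \<comment> \<open>The approximation costs \<open>e / 8 + e / 8\<close> and the average of
      \<open>v\<close> another \<open>e / 8\<close>, which stays below \<open>e / 2\<close>.\<close>
    then have e: "e / 8 > 0" by simp
    from assms[OF e] obtain v m where v: "avg_tendsto v m" "avg_le (\<lambda>n. \<bar>u n - v n\<bar>) (e / 8)"
      by blast
    have "\<forall>\<^sub>F k in sequentially. dist ((\<Sum>n=1..k. v n) / real k) m < e / 8"
      using v(1) e unfolding avg_tendsto_def by (rule tendstoD)
    with avg_leD[OF v(2) e] eventually_gt_at_top[of 0]
    have "\<forall>\<^sub>F k in sequentially. dist (?U k) m < e / 2"
    proof eventually_elim
      case (elim k)
      have "\<bar>(\<Sum>n=1..k. u n) - (\<Sum>n=1..k. v n)\<bar> \<le> (\<Sum>n=1..k. \<bar>u n - v n\<bar>)"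
        by (simp add: sum_subtractf[symmetric])
      also have "\<dots> \<le> (e / 4) * real k" using elim by simp
      finally have "\<bar>(\<Sum>n=1..k. u n) - (\<Sum>n=1..k. v n)\<bar> / real k \<le> e / 4"
        using elim by (simp add: field_simps)
      then have "\<bar>?U k - (\<Sum>n=1..k. v n) / real k\<bar> \<le> e / 4"
        by (simp add: abs_divide flip: diff_divide_distrib)
      with elim \<open>e > 0\<close> show ?case unfolding dist_real_def by linarith
    qed
    then obtain K where K: "\<And>k. k \<ge> K \<Longrightarrow> dist (?U k) m < e / 2"
      by (auto simp: eventually_sequentially)
    have "dist (?U i) (?U j) < e" if "i \<ge> K" "j \<ge> K" for i j
      using K[OF that(1)] K[OF that(2)] by (rule dist_triangle_half_l)
    then show "\<exists>M. \<forall>i\<ge>M. \<forall>j\<ge>M. dist (?U i) (?U j) < e" by blast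
  qed
  then show ?thesis
    unfolding avg_tendsto_def by (simp add: Cauchy_convergent_iff convergent_def)
qed

section \<open>Passage between integer and real cutoffs\<close>

lemma filterlim_nat_floor_at_top: "filterlim (\<lambda>x::real. nat \<lfloor>x\<rfloor>) at_top at_top"
  by (rule filterlim_compose[OF filterlim_nat_sequentially filterlim_floor_sequentially])

lemma Collect_le_real_eq: "{n. 1 \<le> n \<and> real n \<le> x} = {1..nat \<lfloor>x\<rfloor>}"
  by (auto; linarith)

lemma has_mean_value_if_avg_tendsto:
  assumes "avg_tendsto u m"
  shows "has_mean_value u m"
proof -
  have 1: "((\<lambda>x::real. (\<Sum>n=1..nat \<lfloor>x\<rfloor>. u n) / real (nat \<lfloor>x\<rfloor>)) \<longlongrightarrow> m) at_top"
    using filterlim_compose[OF assms[unfolded avg_tendsto_def] filterlim_nat_floor_at_top] .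
  have 2: "((\<lambda>x::real. real (nat \<lfloor>x\<rfloor>) / x) \<longlongrightarrow> 1) at_top"
  proof (rule tendsto_sandwich)
    show "\<forall>\<^sub>F x::real in at_top. 1 - 1 / x \<le> real (nat \<lfloor>x\<rfloor>) / x"
      using eventually_gt_at_top[of 0]
    proof eventually_elim
      case (elim x)
      have "x - 1 \<le> real (nat \<lfloor>x\<rfloor>)" using elim by linarith
      then have "(x - 1) / x \<le> real (nat \<lfloor>x\<rfloor>) / x" using elim by (intro divide_right_mono) auto
      then show ?case using elim by (simp add: diff_divide_distrib)
    qed
    show "\<forall>\<^sub>F x::real in at_top. real (nat \<lfloor>x\<rfloor>) / x \<le> 1"
      using eventually_gt_at_top[of 0]
    proof eventually_elim
      case (elim x)
      have "real (nat \<lfloor>x\<rfloor>) \<le> x" using elim by linarith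
      then show ?case using elim by simp
    qed
    have "((\<lambda>x::real. 1 / x) \<longlongrightarrow> 0) at_top"
      using tendsto_inverse_0_at_top[OF filterlim_ident] by (simp add: inverse_eq_divide)
    then show "((\<lambda>x::real. 1 - 1 / x) \<longlongrightarrow> 1) at_top"
      using tendsto_diff[OF tendsto_const] by force
  qed simp
  have "((\<lambda>x::real. (real (nat \<lfloor>x\<rfloor>) / x) * ((\<Sum>n=1..nat \<lfloor>x\<rfloor>. u n) / real (nat \<lfloor>x\<rfloor>))) \<longlongrightarrow> 1 * m) at_top"
    by (rule tendsto_mult[OF 2 1])
  moreover have "(real (nat \<lfloor>x\<rfloor>) / x) * ((\<Sum>n=1..nat \<lfloor>x\<rfloor>. u n) / real (nat \<lfloor>x\<rfloor>))
      = (1 / x) *\<^sub>R (\<Sum>n | 1 \<le> n \<and> real n \<le> x. u n)" for x :: real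
    \<comment> \<open>If the floor is 0, both sides vanish: the sum is empty and division by 0
      yields 0.\<close>
    unfolding Collect_le_real_eq by (cases "nat \<lfloor>x\<rfloor> = 0") auto
  ultimately show ?thesis by (simp add: has_mean_value_def)
qed

lemma avg_tendsto_if_has_asymp_density:
  assumes "has_asymp_density A \<delta>"
  shows "avg_tendsto (\<lambda>n. of_bool (n \<in> A)) \<delta>"
proof -
  have "(\<lambda>k. real (card {n \<in> A. 1 \<le> n \<and> real n \<le> real k}) / real k) \<longlonglongrightarrow> \<delta>"
    using filterlim_compose[OF assms[unfolded has_asymp_density_def] filterlim_real_sequentially] .
  moreover have "real (card {n \<in> A. 1 \<le> n \<and> real n \<le> real k}) = (\<Sum>n=1..k. of_bool (n \<in> A))" for k
  proof -
    have "{n \<in> A. 1 \<le> n \<and> real n \<le> real k} = {1..k} \<inter> {n. n \<in> A}" by auto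
    then show ?thesis by simp
  qed
  ultimately show ?thesis by (simp add: avg_tendsto_def)
qed

section \<open>Bounded multiplicative functions\<close>

text \<open>For positive \<open>n\<close> this is a unitary divisor: prime powers are kept in full,
  so it is coprime to the complementary divisor.\<close>

definition prime_part :: "nat set \<Rightarrow> nat \<Rightarrow> nat" where
  "prime_part S n = (\<Prod>p\<in>S \<inter> prime_factors n. p ^ multiplicity p n)"

lemma prime_part_mult_compl:
  assumes "n > 0"
  shows "prime_part S n * prime_part (- S) n = n"
proof -
  have "prime_part S n * prime_part (- S) n =
      (\<Prod>p\<in>(S \<inter> prime_factors n) \<union> (- S \<inter> prime_factors n). p ^ multiplicity p n)"
    unfolding prime_part_def by (subst prod.union_disjoint) auto
  also have "(S \<inter> prime_factors n) \<union> (- S \<inter> prime_factors n) = prime_factors n" by blast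
  finally show ?thesis using assms prime_factorization_nat by simp
qed

lemma prime_part_pos: "prime_part S n > 0"
  unfolding prime_part_def by (intro prod_pos) (auto dest: in_prime_factors_imp_prime simp: prime_gt_0_nat)

lemma coprime_prime_part_compl: "coprime (prime_part S n) (prime_part (- S) n)"
  unfolding prime_part_def
proof (intro prod_coprime_left prod_coprime_right)
  fix p q assume pq: "p \<in> S \<inter> prime_factors n" "q \<in> - S \<inter> prime_factors n"
  then have "coprime p q" by (intro primes_coprime) auto
  then show "coprime (p ^ multiplicity p n) (q ^ multiplicity q n)" by simp
qed

lemma prime_dvd_prime_part:
  assumes "prime p" and "p dvd prime_part S n"
  shows "p \<in> S"
proof -
  from assms obtain q where q: "q \<in> S" "q \<in> prime_factors n" "p dvd q ^ multiplicity q n"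
    unfolding prime_part_def by (auto simp: prime_dvd_prod_iff)
  then have "p dvd q" using assms(1) prime_dvd_power by blast
  then have "p = q" using q assms(1) primes_dvd_imp_eq in_prime_factors_imp_prime by blast
  with q show ?thesis by simp
qed

lemma coprime_if_no_common_prime:
  fixes a b :: nat
  assumes "\<And>p. prime p \<Longrightarrow> p dvd a \<Longrightarrow> \<not> p dvd b"
  shows "coprime a b"
proof (rule ccontr)
  assume "\<not> coprime a b"
  then have "gcd a b \<noteq> 1" by (simp add: coprime_iff_gcd_eq_1)
  then obtain p where "prime p" "p dvd gcd a b" using prime_factor_nat by blast
  with assms show False by auto
qed

text \<open>Unlike the part of \<open>n\<close> composed of primes up to \<open>Y\<close>, the product of the exact prime power
  divisors of size at most \<open>Y\<close> is a periodic function of \<open>n\<close>.\<close>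

definition small_part :: "nat \<Rightarrow> nat \<Rightarrow> nat" where
  "small_part Y n = prime_part {p. p ^ multiplicity p n \<le> Y} n"

lemma multiplicity_eq_iff_nat:
  fixes p n e :: nat
  assumes "n > 0" and "prime p"
  shows "multiplicity p n = e \<longleftrightarrow> p ^ e dvd n \<and> \<not> p ^ Suc e dvd n"
  using assms multiplicity_eqI multiplicity_dvd
  by (metis lessI linorder_not_less not_prime_unit power_dvd_iff_le_multiplicity bot_nat_0.not_eq_extremum)

text \<open>Whether \<open>e\<close> is the exact exponent of \<open>p\<close> in \<open>n\<close>
  depends only on \<open>n\<close> modulo \<open>p ^ Suc e\<close>, which divides the period
  whenever \<open>e > 0\<close> and \<open>p ^ e \<le> Y\<close>.\<close>

lemma small_part_periodic:
  assumes "n > 0"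
  shows "small_part Y (n + (fact Y)\<^sup>2) = small_part Y n"
proof -
  define n' where "n' = n + (fact Y)\<^sup>2"
  have n': "n' > 0" using assms by (simp add: n'_def)
  have eq: "multiplicity p n' = e \<longleftrightarrow> multiplicity p n = e"
    if p: "prime p" and e: "e > 0" and le: "p ^ e \<le> Y" for p e
  proof -
    have "p > 0" using p by (simp add: prime_gt_0_nat)
    then have 1: "p ^ e dvd (fact Y :: nat)" using le by (intro dvd_fact) auto
    have "p \<le> p ^ e" using e \<open>p > 0\<close> by (simp add: self_le_power)
    then have 2: "p dvd (fact Y :: nat)" using le \<open>p > 0\<close> by (intro dvd_fact) auto
    \<comment> \<open>One factorial supplies \<open>p ^ e\<close> and the other the extra
      \<open>p\<close>; hence the square.\<close>
    have "p ^ Suc e dvd (fact Y)\<^sup>2"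
      using mult_dvd_mono[OF 2 1] by (simp add: power2_eq_square)
    moreover from this have "p ^ e dvd (fact Y)\<^sup>2" by (auto intro: dvd_trans[rotated])
    ultimately have "p ^ e dvd n' \<longleftrightarrow> p ^ e dvd n" "p ^ Suc e dvd n' \<longleftrightarrow> p ^ Suc e dvd n"
      unfolding n'_def by (auto simp: dvd_add_left_iff simp del: power_Suc)
    then show ?thesis
      unfolding multiplicity_eq_iff_nat[OF n' p] multiplicity_eq_iff_nat[OF assms p] by simp
  qed
  have S: "{p. p ^ multiplicity p m \<le> Y} \<inter> prime_factors m =
      {p. prime p \<and> multiplicity p m > 0 \<and> p ^ multiplicity p m \<le> Y}" if "m > 0" for m
    using that by (auto simp: prime_factors_multiplicity)
  show ?thesis
    unfolding small_part_def prime_part_def n'_def[symmetric] S[OF assms] S[OF n']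
  proof (rule prod.cong)
    show "{p. prime p \<and> multiplicity p n' > 0 \<and> p ^ multiplicity p n' \<le> Y} =
        {p. prime p \<and> multiplicity p n > 0 \<and> p ^ multiplicity p n \<le> Y}"
      using eq by (metis (no_types, lifting))
    fix p assume "p \<in> {p. prime p \<and> multiplicity p n > 0 \<and> p ^ multiplicity p n \<le> Y}"
    then show "p ^ multiplicity p n' = p ^ multiplicity p n" using eq by (metis (no_types, lifting) mem_Collect_eq)
  qed
qed

section \<open>Reciprocals of proper prime powers\<close>

lemma sum_powers_from_2_le:
  fixes x :: real
  assumes "0 \<le> x" "x \<le> 1 / 2"
  shows "(\<Sum>j\<in>{2..<N}. x ^ j) \<le> 2 * x\<^sup>2"
proof -
  \<comment> \<open>The extra term dominates the remaining geometric tail and lets the induction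
    close.\<close>
  have *: "(\<Sum>j\<in>{2..<2+k}. x ^ j) + 2 * x ^ (2 + k) \<le> 2 * x\<^sup>2" for k
  proof (induction k)
    case (Suc k)
    have "2 * x * x ^ (2 + k) \<le> 1 * x ^ (2 + k)"
      using assms by (intro mult_right_mono) auto
    with Suc show ?case by simp
  qed simp
  show ?thesis
  proof (cases "N \<ge> 2")
    case True
    then obtain k where "N = 2 + k" using le_Suc_ex by blast
    moreover have "0 \<le> 2 * x ^ (2 + k)" using assms by simp
    ultimately show ?thesis using *[of k] by simp
  qed (use assms in auto)
qed

lemma sum_inverse_squares_from_2_le: "(\<Sum>p\<in>{2..<N}. (1 / real p)\<^sup>2) \<le> 1"
proof -
  \<comment> \<open>Telescoping: the square of \<open>1 / (k + 2)\<close> is at most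
    \<open>1 / (k + 1) - 1 / (k + 2)\<close>.\<close>
  have *: "(\<Sum>p\<in>{2..<2+k}. (1 / real p)\<^sup>2) \<le> 1 - 1 / (real k + 1)" for k
  proof (induction k)
    case (Suc k)
    have "(1 / real (2 + k))\<^sup>2 \<le> (1 / (real k + 1)) * (1 / (real k + 2))"
      unfolding power2_eq_square by (intro mult_mono) (auto simp: field_simps)
    also have "\<dots> = 1 / (real k + 1) - 1 / (real k + 2)" by (simp add: field_simps)
    finally have "(1 / real (2 + k))\<^sup>2 \<le> 1 / (real k + 1) - 1 / (real (Suc k) + 1)" by (simp add: add.commute)
    with Suc show ?case
      unfolding add_Suc_right sum.atLeastLessThan_Suc[OF le_add1] by linarith
  qed simp
  show ?thesis
  proof (cases "N \<ge> 2")
    case True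
    then obtain k where N: "N = 2 + k" using le_Suc_ex by blast
    have "0 \<le> 1 / (real k + 1)" by simp
    with *[of k] show ?thesis unfolding N by linarith
  qed simp
qed

definition proper_prime_powers :: "nat set" where
  "proper_prime_powers = {p ^ j | p j. prime p \<and> j \<ge> 2}"

lemma summable_proper_prime_powers:
  "summable (\<lambda>q. of_bool (q \<in> proper_prime_powers) / real q)"
proof (rule summableI_nonneg_bounded)
  fix N :: nat
  let ?E = "proper_prime_powers"
  \<comment> \<open>Base and exponent are both at most \<open>p ^ j\<close>, so a finite square of
    pairs suffices.\<close>
  have sub: "{..<N} \<inter> ?E \<subseteq> (\<lambda>(p, j). p ^ j) ` ({2..<N} \<times> {2..<N})"
  proof
    fix q assume "q \<in> {..<N} \<inter> ?E"
    then obtain p j where q: "q = p ^ j" "prime p" "j \<ge> 2" "q < N"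
      by (auto simp: proper_prime_powers_def)
    have p: "p \<ge> 2" using q prime_ge_2_nat by blast
    have "p \<le> p ^ j" using p q by (intro self_le_power) auto
    moreover have "j < p ^ j"
      using less_le_trans[OF less_exp power_mono[OF p]] by simp
    ultimately show "q \<in> (\<lambda>(p, j). p ^ j) ` ({2..<N} \<times> {2..<N})"
      using q p by (intro image_eqI[of _ _ "(p, j)"]) auto
  qed
  have "(\<Sum>q<N. of_bool (q \<in> ?E) / real q) = (\<Sum>q\<in>{..<N} \<inter> ?E. 1 / real q)"
    by (rule sum.mono_neutral_cong_right) auto
  also have "\<dots> \<le> (\<Sum>q\<in>(\<lambda>(p, j). p ^ j) ` ({2..<N} \<times> {2..<N}). 1 / real q)"
    using sub by (intro sum_mono2) auto
  also have "\<dots> \<le> (\<Sum>(p, j)\<in>{2..<N} \<times> {2..<N}. (1 / real p) ^ j)"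
    by (rule order_trans[OF sum_image_le]) (auto simp: case_prod_unfold power_divide)
  also have "\<dots> = (\<Sum>p\<in>{2..<N}. \<Sum>j\<in>{2..<N}. (1 / real p) ^ j)"
    by (simp add: sum.cartesian_product)
  also have "\<dots> \<le> (\<Sum>p\<in>{2..<N}. 2 * (1 / real p)\<^sup>2)"
    by (intro sum_mono sum_powers_from_2_le) (auto simp: field_simps)
  also have "\<dots> \<le> 2"
    using sum_inverse_squares_from_2_le[of N] by (simp flip: sum_distrib_left)
  finally show "(\<Sum>q<N. of_bool (q \<in> ?E) / real q) \<le> 2" .
qed simp

text \<open>The factor at a new prime \<open>p\<close> is 1 minus \<open>1 - c p\<close> times the
  difference of the indicators of divisibility by \<open>p\<close> and by \<open>p\<^sup>2\<close>.
  The remaining product \<open>u\<close> ignores factors \<open>p\<close>, so its product with these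
  indicators is a dilate of \<open>u\<close>.\<close>

lemma avg_tendsto_prod_exactly_once:
  fixes c :: "nat \<Rightarrow> real"
  assumes "finite T" and "\<And>p. p \<in> T \<Longrightarrow> prime p"
  shows "avg_tendsto (\<lambda>n. \<Prod>p\<in>T. if multiplicity p n = 1 then c p else 1)
           (\<Prod>p\<in>T. 1 - (1 - c p) * (1 / real p - 1 / (real p)\<^sup>2))"
  using assms
proof (induction T)
  case empty
  show ?case by (simp add: avg_tendsto_1)
next
  case (insert p T)
  define u where "u n = (\<Prod>q\<in>T. if multiplicity q n = 1 then c q else 1)" for n
  define m where "m = (\<Prod>q\<in>T. 1 - (1 - c q) * (1 / real q - 1 / (real q)\<^sup>2))"
  have p: "prime p" using insert by simp
  have um: "avg_tendsto u m" using insert by (simp add: u_def[abs_def] m_def)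
  have up: "u (p * n) = u n" for n
    unfolding u_def
  proof (intro prod.cong refl)
    fix q assume q: "q \<in> T"
    then have "prime q" "q \<noteq> p" using insert by auto
    then have "multiplicity q (p * n) = multiplicity q n"
      using p by (intro multiplicity_prime_elem_times_other) (auto dest: primes_dvd_imp_eq)
    then show "(if multiplicity q (p * n) = 1 then c q else 1) = (if multiplicity q n = 1 then c q else 1)"
      by simp
  qed
  have upp: "u (p\<^sup>2 * n) = u n" for n
    using up[of "p * n"] up[of n] by (simp add: power2_eq_square mult.assoc)
  have d1: "dilate p u n = (if p dvd n then u n else 0)" for n
    using up p by (auto simp: dilate_def elim!: dvdE)
  have d2: "dilate (p\<^sup>2) u n = (if p\<^sup>2 dvd n then u n else 0)" for n
    using upp p by (auto simp: dilate_def elim!: dvdE)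
  have "p > 0" using p by (simp add: prime_gt_0_nat)
  then have "avg_tendsto (\<lambda>n. u n + (- (1 - c p) * dilate p u n + (1 - c p) * dilate (p\<^sup>2) u n))
      (m + (- (1 - c p) * (m / real p) + (1 - c p) * (m / real (p\<^sup>2))))"
    by (intro avg_tendsto_add avg_tendsto_mult_left avg_tendsto_dilate um) auto
  moreover have "u n + (- (1 - c p) * dilate p u n + (1 - c p) * dilate (p\<^sup>2) u n)
      = (\<Prod>q\<in>insert p T. if multiplicity q n = 1 then c q else 1)" if "n > 0" for n
  proof -
    have "multiplicity p n = 1 \<longleftrightarrow> p dvd n \<and> \<not> p\<^sup>2 dvd n"
      using multiplicity_eq_iff_nat[OF that p, of 1] by (simp add: power2_eq_square)
    moreover have "p\<^sup>2 dvd n \<Longrightarrow> p dvd n" by (metis dvd_power dvd_trans zero_less_numeral)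
    ultimately have "u n + (- (1 - c p) * dilate p u n + (1 - c p) * dilate (p\<^sup>2) u n)
      = (if multiplicity p n = 1 then c p else 1) * u n"
      unfolding d1 d2 by (auto simp: algebra_simps)
    then show ?thesis using insert by (simp add: u_def)
  qed
  ultimately have "avg_tendsto (\<lambda>n. \<Prod>q\<in>insert p T. if multiplicity q n = 1 then c q else 1)
      (m + (- (1 - c p) * (m / real p) + (1 - c p) * (m / real (p\<^sup>2))))"
    by (rule avg_tendsto_cong)
  moreover have "m + (- (1 - c p) * (m / real p) + (1 - c p) * (m / real (p\<^sup>2)))
      = (\<Prod>q\<in>insert p T. 1 - (1 - c q) * (1 / real q - 1 / (real q)\<^sup>2))"
  proof -
    have "m + (- (1 - c p) * (m / real p) + (1 - c p) * (m / real (p\<^sup>2)))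
        = (1 - (1 - c p) * (1 / real p - 1 / (real p)\<^sup>2)) * m"
      by (simp add: algebra_simps diff_divide_distrib)
    then show ?thesis using insert by (simp add: m_def)
  qed
  ultimately show ?case by simp
qed

section \<open>Nonnegative bounded multiplicative functions, to be applied to the absolute value of
  \<nu>\<close>

locale bounded_multiplicative =
  fixes h :: "nat \<Rightarrow> real" and B :: real
  assumes at_1: "h 1 = 1"
    and mult: "\<And>m n. m > 0 \<Longrightarrow> n > 0 \<Longrightarrow> coprime m n \<Longrightarrow> h (m * n) = h m * h n"
    and nonneg: "\<And>n. n > 0 \<Longrightarrow> h n \<ge> 0"
    and bound: "\<And>n. n > 0 \<Longrightarrow> h n \<le> B"
begin

lemma B_ge_1: "B \<ge> 1"
  using bound[of 1] at_1 by simp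

lemma mult_prime_power_prod:
  assumes "finite S" and "p \<notin> S" and "\<And>q. q \<in> insert p S \<Longrightarrow> prime q"
  shows "h (p ^ e p * (\<Prod>q\<in>S. q ^ e q)) = h (p ^ e p) * h (\<Prod>q\<in>S. q ^ e q)"
proof (rule mult)
  show "p ^ e p > 0" using assms by (auto simp: prime_gt_0_nat)
  show "(\<Prod>q\<in>S. q ^ e q) > 0" using assms by (intro prod_pos) (auto simp: prime_gt_0_nat)
  show "coprime (p ^ e p) (\<Prod>q\<in>S. q ^ e q)"
  proof (rule prod_coprime_right)
    fix q assume "q \<in> S"
    then have "coprime p q" using assms by (intro primes_coprime) auto
    then show "coprime (p ^ e p) (q ^ e q)" by simp
  qed
qed

lemma prod_prime_powers:
  assumes "finite S" and "\<And>p. p \<in> S \<Longrightarrow> prime p"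
  shows "h (\<Prod>p\<in>S. p ^ e p) = (\<Prod>p\<in>S. h (p ^ e p))"
  using assms
proof (induction S)
  case (insert p S)
  then have "h (p ^ e p * (\<Prod>q\<in>S. q ^ e q)) = h (p ^ e p) * h (\<Prod>q\<in>S. q ^ e q)"
    by (intro mult_prime_power_prod) auto
  with insert show ?case by simp
qed (use at_1 in auto)

text \<open>Primes are peeled off one at a time. The remaining product is itself a value of
  \<open>h\<close>, hence at most \<open>B\<close>, so the constant does not grow with the number of
  primes.\<close>

lemma abs_prod_prime_powers_minus_1_le:
  assumes "finite S" and "\<And>p. p \<in> S \<Longrightarrow> prime p"
  shows "\<bar>h (\<Prod>p\<in>S. p ^ e p) - 1\<bar> \<le> B * (\<Sum>p\<in>S. \<bar>h (p ^ e p) - 1\<bar>)"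
  using assms
proof (induction S)
  case (insert p S)
  define x where "x = h (\<Prod>q\<in>S. q ^ e q)"
  have pos: "(\<Prod>q\<in>S. q ^ e q) > 0" using insert by (intro prod_pos) (auto simp: prime_gt_0_nat)
  then have x: "0 \<le> x" "x \<le> B" by (auto simp: x_def nonneg bound)
  have "h (\<Prod>q\<in>insert p S. q ^ e q) = h (p ^ e p) * x"
    using insert mult_prime_power_prod[of S p e] by (simp add: x_def)
  then have "\<bar>h (\<Prod>q\<in>insert p S. q ^ e q) - 1\<bar> = \<bar>x * (h (p ^ e p) - 1) + (x - 1)\<bar>"
    by (simp add: algebra_simps)
  also have "\<dots> \<le> x * \<bar>h (p ^ e p) - 1\<bar> + \<bar>x - 1\<bar>"
    using abs_triangle_ineq[of "x * (h (p ^ e p) - 1)" "x - 1"] x by (simp add: abs_mult)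
  also have "\<dots> \<le> B * \<bar>h (p ^ e p) - 1\<bar> + B * (\<Sum>p\<in>S. \<bar>h (p ^ e p) - 1\<bar>)"
    using insert x by (intro add_mono mult_right_mono) (auto simp: x_def)
  finally show ?case using insert by (simp add: distrib_left)
qed (use at_1 in auto)

text \<open>The product of the \<open>h p\<close> is a single value of \<open>h\<close>, so it is at
  most \<open>B\<close>; it also exceeds the sum of the excesses, as seen by expanding it.\<close>

lemma sum_excess_le:
  assumes "finite S" and "\<And>p. p \<in> S \<Longrightarrow> prime p" and "\<And>p. p \<in> S \<Longrightarrow> h p \<ge> 1"
  shows "(\<Sum>p\<in>S. h p - 1) \<le> B"
proof -
  have "1 + (\<Sum>p\<in>S. h p - 1) \<le> (\<Prod>p\<in>S. h p)"
    using assms(1,3)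
  proof (induction S)
    case (insert p S)
    have "0 \<le> (\<Sum>q\<in>S. h q - 1)" using insert by (intro sum_nonneg) auto
    then have "(h p - 1) * 1 \<le> (h p - 1) * (\<Prod>q\<in>S. h q)"
      using insert by (intro mult_left_mono) auto
    with insert show ?case by (simp add: algebra_simps)
  qed simp
  also have "\<dots> = h (\<Prod>p\<in>S. p ^ 1)" using prod_prime_powers[OF assms(1,2), of "\<lambda>_. 1"] by simp
  also have "\<dots> \<le> B" using assms by (intro bound prod_pos) (auto simp: prime_gt_0_nat)
  finally show ?thesis by simp
qed

text \<open>Only the deficit is a matter of assumption: the excess over 1 has a bounded sum even
  without the weights \<open>1 / p\<close>.\<close>

lemma summable_deviation:
  assumes "summable (\<lambda>p. of_bool (prime p \<and> h p < 1) * ((1 - h p) / real p))"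
  shows "summable (\<lambda>p. of_bool (prime p) * (\<bar>h p - 1\<bar> / real p))"
proof -
  have "summable (\<lambda>p. of_bool (prime p \<and> h p \<ge> 1) * ((h p - 1) / real p))"
  proof (rule summableI_nonneg_bounded)
    fix N :: nat
    have "(\<Sum>p<N. of_bool (prime p \<and> h p \<ge> 1) * ((h p - 1) / real p))
        = (\<Sum>p | p < N \<and> prime p \<and> h p \<ge> 1. (h p - 1) / real p)"
      by (rule sum.mono_neutral_cong_right) auto
    also have "\<dots> \<le> (\<Sum>p | p < N \<and> prime p \<and> h p \<ge> 1. h p - 1)"
    proof (intro sum_mono)
      fix p assume "p \<in> {p. p < N \<and> prime p \<and> h p \<ge> 1}"
      then have "real p \<ge> 1" "h p \<ge> 1" using prime_ge_1_nat[of p] by auto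
      then have "(h p - 1) / real p \<le> (h p - 1) / 1" by (intro divide_left_mono) auto
      then show "(h p - 1) / real p \<le> h p - 1" by simp
    qed
    also have "\<dots> \<le> B" by (rule sum_excess_le) auto
    finally show "(\<Sum>p<N. of_bool (prime p \<and> h p \<ge> 1) * ((h p - 1) / real p)) \<le> B" .
  qed (auto)
  from summable_add[OF assms this] show ?thesis
    by (rule summable_cong[THEN iffD1, rotated]) (auto intro!: always_eventually)
qed

text \<open>Split off the primes of \<open>T\<close> dividing \<open>n\<close> exactly once. The
  complementary divisor is positive, so all of it together costs only one factor
  \<open>B\<close>.\<close>

lemma le_prod_exactly_once:
  assumes "n > 0" and "finite T" and T: "\<And>p. p \<in> T \<Longrightarrow> prime p"
  shows "h n \<le> B * (\<Prod>p\<in>T. if multiplicity p n = 1 then h p else 1)"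
proof -
  define S where "S = {p \<in> T. multiplicity p n = 1}"
  have S: "S \<inter> prime_factors n = S"
    using assms by (auto simp: S_def prime_factors_multiplicity)
  have "finite S" using assms by (simp add: S_def)
  have "h n = h (prime_part S n) * h (prime_part (- S) n)"
    using mult[OF prime_part_pos prime_part_pos coprime_prime_part_compl]
    by (metis prime_part_mult_compl assms(1))
  also have "h (prime_part S n) = (\<Prod>p\<in>S. h (p ^ multiplicity p n))"
    unfolding prime_part_def S using T \<open>finite S\<close> by (intro prod_prime_powers) (auto simp: S_def)
  also have "\<dots> = (\<Prod>p\<in>S. h p)" by (intro prod.cong) (auto simp: S_def)
  also have "\<dots> = (\<Prod>p\<in>T. if multiplicity p n = 1 then h p else 1)"
    unfolding S_def using assms(2) by (rule prod.inter_filter)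
  finally have "h n = (\<Prod>p\<in>T. if multiplicity p n = 1 then h p else 1) * h (prime_part (- S) n)" .
  also have "\<dots> \<le> (\<Prod>p\<in>T. if multiplicity p n = 1 then h p else 1) * B"
    using T by (intro mult_left_mono bound prime_part_pos prod_nonneg) (auto simp: nonneg prime_gt_0_nat)
  finally show ?thesis by (simp add: mult.commute)
qed

lemma avg_le_0_if_not_summable:
  assumes "\<not> summable (\<lambda>p. of_bool (prime p \<and> h p < 1) * ((1 - h p) / real p))"
  shows "avg_le h 0"
proof (rule avg_le_limit)
  fix e :: real assume e: "e > 0"
  define a where "a p = of_bool (prime p \<and> h p < 1) * ((1 - h p) / real p)" for p
  have a0: "a p \<ge> 0" for p by (auto simp: a_def)
  \<comment> \<open>The threshold is chosen so that \<open>B\<close> times the exponential of minus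
    half the partial sum is at most \<open>e\<close>.\<close>
  obtain N where N: "(\<Sum>p<N. a p) > 2 * ln (B / e)"
  proof -
    have "\<not> (\<forall>N. (\<Sum>p<N. a p) \<le> 2 * ln (B / e))"
      using summableI_nonneg_bounded[of a, OF a0] assms by (auto simp: a_def[abs_def])
    then show ?thesis using that by (auto simp: not_le)
  qed
  define T where "T = {p. p < N \<and> prime p \<and> h p < 1}"
  have T: "finite T" "\<And>p. p \<in> T \<Longrightarrow> prime p" by (auto simp: T_def)
  \<comment> \<open>Here \<open>1 - 1 / p\<close> is at least \<open>1 / 2\<close>, and
    \<open>1 + t \<le> exp t\<close> with \<open>t = - (a p / 2)\<close> bounds each factor.\<close>
  have "(\<Prod>p\<in>T. 1 - (1 - h p) * (1 / real p - 1 / (real p)\<^sup>2)) \<le> (\<Prod>p\<in>T. exp (- (a p / 2)))"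
  proof (rule prod_mono, intro conjI)
    fix p assume "p \<in> T"
    then have p: "real p \<ge> 2" "h p < 1" "a p = (1 - h p) / real p" "h p \<ge> 0"
      by (auto simp: T_def a_def prime_ge_2_nat prime_gt_0_nat intro!: nonneg)
    have r: "1 / real p - 1 / (real p)\<^sup>2 = (1 / real p) * (1 - 1 / real p)"
      by (simp add: power2_eq_square algebra_simps)
    have i: "1 / real p \<le> 1 / 2" using p by (simp add: field_simps)
    have "(1 / real p) * (1 / 2) \<le> (1 / real p) * (1 - 1 / real p)"
      using i p by (intro mult_left_mono) auto
    then have "(1 - h p) * ((1 / real p) * (1 / 2)) \<le> (1 - h p) * (1 / real p - 1 / (real p)\<^sup>2)"
      unfolding r using p by (intro mult_left_mono) auto
    then have "1 - (1 - h p) * (1 / real p - 1 / (real p)\<^sup>2) \<le> 1 + - (a p / 2)"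
      using p by simp
    also have "\<dots> \<le> exp (- (a p / 2))" by (rule exp_ge_add_one_self)
    finally show "1 - (1 - h p) * (1 / real p - 1 / (real p)\<^sup>2) \<le> exp (- (a p / 2))" .
    \<comment> \<open>Multiplying the inequalities also requires the smaller factors to be
      nonnegative.\<close>
    have "(1 / real p) * (1 - 1 / real p) \<le> 1 * 1" using i p by (intro mult_mono) auto
    moreover have "0 \<le> (1 / real p) * (1 - 1 / real p)" using i p by (intro mult_nonneg_nonneg) auto
    ultimately have "(1 - h p) * ((1 / real p) * (1 - 1 / real p)) \<le> 1 * 1" using p by (intro mult_mono) auto
    then show "0 \<le> 1 - (1 - h p) * (1 / real p - 1 / (real p)\<^sup>2)" unfolding r by simp
  qed
  also have "\<dots> = exp (- ((\<Sum>p\<in>T. a p) / 2))"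
    using T by (simp add: exp_sum[symmetric] sum_negf sum_divide_distrib)
  also have "(\<Sum>p\<in>T. a p) = (\<Sum>p<N. a p)"
    by (rule sum.mono_neutral_left) (auto simp: T_def a_def)
  also have "exp (- ((\<Sum>p<N. a p) / 2)) \<le> exp (- ln (B / e))" using N by simp
  also have "\<dots> = e / B" using e B_ge_1 by (simp add: exp_minus)
  finally have "B * (\<Prod>p\<in>T. 1 - (1 - h p) * (1 / real p - 1 / (real p)\<^sup>2)) \<le> 0 + e"
    using B_ge_1 by (simp add: field_simps)
  moreover have "avg_le (\<lambda>n. B * (\<Prod>p\<in>T. if multiplicity p n = 1 then h p else 1))
      (B * (\<Prod>p\<in>T. 1 - (1 - h p) * (1 / real p - 1 / (real p)\<^sup>2)))"
    using B_ge_1 T by (intro avg_le_cmult avg_tendsto_imp_le avg_tendsto_prod_exactly_once) auto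
  ultimately show "avg_le h (0 + e)"
    using T by (intro avg_le_mono[OF _ le_prod_exactly_once]) auto
qed

end

section \<open>Existence of the mean value\<close>

locale dirichlet_factor =
  fixes \<nu> f g :: "nat \<Rightarrow> complex" and B :: real
  assumes multiplicative: "arith_multiplicative \<nu>"
    and norm_bound: "\<And>n. n > 0 \<Longrightarrow> norm (\<nu> n) \<le> B"
    and conv: "\<And>n. n > 0 \<Longrightarrow> g n = dirichlet_conv f \<nu> n"
    and summable_f: "summable (\<lambda>n. norm (f n) / real n)"
begin

lemma at_1: "\<nu> 1 = 1" and mult: "m > 0 \<Longrightarrow> n > 0 \<Longrightarrow> coprime m n \<Longrightarrow> \<nu> (m * n) = \<nu> m * \<nu> n"
  using multiplicative by (auto simp: arith_multiplicative_def)

sublocale abs_nu: bounded_multiplicative "\<lambda>n. norm (\<nu> n)" B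
  by unfold_locales (use at_1 mult norm_bound in \<open>auto simp: norm_mult\<close>)

section \<open>Truncation of the convolution to small divisors\<close>

definition trunc_conv :: "nat \<Rightarrow> nat \<Rightarrow> complex" where
  "trunc_conv y n = (\<Sum>d | d dvd n \<and> d \<le> y. f d * \<nu> (n div d))"

lemma norm_diff_trunc_conv_le:
  assumes "n > 0"
  shows "norm (g n - trunc_conv y n) \<le> B * (\<Sum>d | d dvd n \<and> d > y. norm (f d))"
proof -
  have "g n = (\<Sum>d\<in>{d. d dvd n \<and> d \<le> y} \<union> {d. d dvd n \<and> d > y}. f d * \<nu> (n div d))"
    using conv[OF assms] unfolding dirichlet_conv_def by (auto intro!: sum.cong)
  also have "\<dots> = trunc_conv y n + (\<Sum>d | d dvd n \<and> d > y. f d * \<nu> (n div d))"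
    unfolding trunc_conv_def using assms by (intro sum.union_disjoint) auto
  finally have "norm (g n - trunc_conv y n) \<le> (\<Sum>d | d dvd n \<and> d > y. norm (f d * \<nu> (n div d)))"
    by (simp add: norm_sum)
  also have "\<dots> \<le> (\<Sum>d | d dvd n \<and> d > y. B * norm (f d))"
  proof (rule sum_mono)
    fix d assume "d \<in> {d. d dvd n \<and> d > y}"
    then have "n div d > 0" using assms by (auto elim!: dvdE)
    then show "norm (f d * \<nu> (n div d)) \<le> B * norm (f d)"
      using mult_left_mono[OF norm_bound norm_ge_zero, of "n div d" "f d"] by (simp add: norm_mult mult.commute)
  qed
  finally show ?thesis by (simp add: sum_distrib_left)
qed

text \<open>A crude bound uniform in \<open>n\<close>, to be paid in full at exceptional
  \<open>n\<close>.\<close>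

lemma norm_trunc_conv_le:
  assumes "n > 0"
  shows "norm (trunc_conv y n) \<le> B * (\<Sum>d\<le>y. norm (f d))"
proof -
  have "norm (trunc_conv y n) \<le> (\<Sum>d | d dvd n \<and> d \<le> y. B * norm (f d))"
    unfolding trunc_conv_def
  proof (rule sum_norm_le)
    fix d assume "d \<in> {d. d dvd n \<and> d \<le> y}"
    then have "n div d > 0" using assms by (auto elim!: dvdE)
    then show "norm (f d * \<nu> (n div d)) \<le> B * norm (f d)"
      using mult_left_mono[OF norm_bound norm_ge_zero, of "n div d" "f d"] by (simp add: norm_mult mult.commute)
  qed
  also have "\<dots> \<le> (\<Sum>d\<le>y. B * norm (f d))"
    using abs_nu.B_ge_1 by (intro sum_mono2) auto
  finally show ?thesis by (simp add: sum_distrib_left)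
qed

text \<open>All divisors that occur in the sum already divide \<open>a\<close>, so \<open>b\<close>
  passes untouched into the argument of \<nu> and factors out.\<close>

lemma trunc_conv_mult:
  assumes "a > 0" and "b > 0" and "coprime a b"
    and "\<And>d. d dvd a * b \<Longrightarrow> d \<le> y \<Longrightarrow> d dvd a"
  shows "trunc_conv y (a * b) = trunc_conv y a * \<nu> b"
proof -
  have "{d. d dvd a * b \<and> d \<le> y} = {d. d dvd a \<and> d \<le> y}" using assms(4) by auto
  then have "trunc_conv y (a * b) = (\<Sum>d | d dvd a \<and> d \<le> y. f d * \<nu> (a * b div d))"
    by (simp add: trunc_conv_def)
  also have "\<dots> = (\<Sum>d | d dvd a \<and> d \<le> y. f d * \<nu> (a div d) * \<nu> b)"
  proof (rule sum.cong[OF refl])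
    fix d assume "d \<in> {d. d dvd a \<and> d \<le> y}"
    then obtain k where k: "a = d * k" by auto
    then have "d > 0" "k > 0" using assms by auto
    moreover have "coprime k b" using assms(3) k by simp
    ultimately show "f d * \<nu> (a * b div d) = f d * \<nu> (a div d) * \<nu> b"
      using mult[of k b] assms(2) k by (simp add: mult.assoc)
  qed
  finally show ?thesis by (simp add: trunc_conv_def sum_distrib_right)
qed

text \<open>The second summand also pays for those \<open>n\<close> whose part composed of primes up to \<open>y\<close> is not
  contained in \<open>small_part Y n\<close>.\<close>

definition deviation :: "nat \<Rightarrow> real" where
  "deviation q = B * (of_bool (prime q) * \<bar>norm (\<nu> q) - 1\<bar>) + (B * B + 1) * of_bool (q \<in> proper_prime_powers)"

lemma deviation_nonneg: "deviation q \<ge> 0"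
  using abs_nu.B_ge_1 by (simp add: deviation_def)

lemma summable_deviation:
  assumes "summable (\<lambda>p. of_bool (prime p) * (\<bar>norm (\<nu> p) - 1\<bar> / real p))"
  shows "summable (\<lambda>q. deviation q / real q)"
  using summable_add[OF summable_mult[OF assms, of B] summable_mult[OF summable_proper_prime_powers, of "B * B + 1"]]
  by (simp add: deviation_def add_divide_distrib)

text \<open>For exponent 1 the first summand suffices; for larger exponents the trivial bound
  \<open>B\<close> on the distance to 1 gives \<open>B * B\<close>.\<close>

lemma deviation_prime_power_ge:
  assumes "prime p" and "e > 0"
  shows "B * \<bar>norm (\<nu> (p ^ e)) - 1\<bar> \<le> deviation (p ^ e)"
proof (cases "e = 1")
  case True
  then show ?thesis using assms abs_nu.B_ge_1 by (simp add: deviation_def)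
next
  case False
  then have "p ^ e \<in> proper_prime_powers"
    using assms unfolding proper_prime_powers_def
    by (intro CollectI exI[of _ p] exI[of _ e]) auto
  moreover have "\<bar>norm (\<nu> (p ^ e)) - 1\<bar> \<le> B"
    using norm_bound[of "p ^ e"] abs_nu.B_ge_1 assms(1) norm_ge_zero[of "\<nu> (p ^ e)"]
    by (simp add: prime_gt_0_nat abs_le_iff del: norm_ge_zero)
  then have "B * \<bar>norm (\<nu> (p ^ e)) - 1\<bar> \<le> B * B" using abs_nu.B_ge_1 by (intro mult_left_mono) auto
  moreover have "0 \<le> B * (of_bool (prime (p ^ e)) * \<bar>norm (\<nu> (p ^ e)) - 1\<bar>)"
    using abs_nu.B_ge_1 by (intro mult_nonneg_nonneg) auto
  ultimately show ?thesis unfolding deviation_def by simp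
qed

lemma norm_trunc_conv_small_part:
  assumes n: "n > 0" and "y \<le> Y"
  shows "\<bar>norm (trunc_conv y n) - norm (trunc_conv y (small_part Y n))\<bar>
      \<le> (B * (\<Sum>d\<le>y. norm (f d))) * (\<Sum>q | q dvd n \<and> q > Y. deviation q)"
proof -
  define S where "S = {p. p ^ multiplicity p n \<le> Y}"
  define a where "a = prime_part S n"
  define b where "b = prime_part (- S) n"
  define C where "C = B * (\<Sum>d\<le>y. norm (f d))"
  have ab: "a > 0" "b > 0" "coprime a b" "a * b = n"
    using n by (auto simp: a_def b_def prime_part_pos coprime_prime_part_compl prime_part_mult_compl)
  have a: "small_part Y n = a" by (simp add: small_part_def a_def S_def)
  have C0: "C \<ge> 0" using abs_nu.B_ge_1 by (auto simp: C_def intro!: mult_nonneg_nonneg sum_nonneg)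
  have aC: "norm (trunc_conv y a) \<le> C" using norm_trunc_conv_le[OF ab(1)] by (simp add: C_def)
  have nC: "norm (trunc_conv y n) \<le> C" using norm_trunc_conv_le[OF n] by (simp add: C_def)
  have fin: "finite {q. q dvd n \<and> q > Y}" using n by simp
  show ?thesis
  proof (cases "\<exists>p\<in>- S \<inter> prime_factors n. p \<le> y")
    \<comment> \<open>Exceptional \<open>n\<close>: a prime \<open>p \<le> y \<le> Y\<close> has its
      exact power above \<open>Y\<close>, so the exponent is at least 2. This proper prime power has
      deviation at least 1 and covers the crude bound \<open>C\<close>.\<close>
    case True
    then obtain p where p: "p \<notin> S" "p \<in> prime_factors n" "p \<le> y" by auto
    define q where "q = p ^ multiplicity p n"
    have "q > Y" using p by (simp add: S_def q_def)
    have "multiplicity p n \<noteq> 0" using p by (auto simp: prime_factors_multiplicity)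
    moreover have "multiplicity p n \<noteq> 1" using p \<open>q > Y\<close> assms(2) by (auto simp: q_def)
    ultimately have "multiplicity p n \<ge> 2" by linarith
    then have q: "q \<in> proper_prime_powers" "q dvd n"
      using p by (auto simp: proper_prime_powers_def q_def multiplicity_dvd)
    have "0 \<le> B * (of_bool (prime q) * \<bar>norm (\<nu> q) - 1\<bar>)" "0 \<le> B * B"
      using abs_nu.B_ge_1 by auto
    then have "1 \<le> deviation q" using q by (simp add: deviation_def)
    also have "\<dots> \<le> (\<Sum>q | q dvd n \<and> q > Y. deviation q)"
      using q \<open>q > Y\<close> fin by (intro member_le_sum) (auto simp: deviation_nonneg)
    finally have "C * 1 \<le> C * (\<Sum>q | q dvd n \<and> q > Y. deviation q)"
      using C0 by (intro mult_left_mono)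
    moreover have "\<bar>norm (trunc_conv y n) - norm (trunc_conv y a)\<bar> \<le> C"
      using aC nC norm_ge_zero[of "trunc_conv y a"] norm_ge_zero[of "trunc_conv y n"] by linarith
    ultimately show ?thesis unfolding a C_def by linarith
  next
    \<comment> \<open>Now \<open>b\<close> has no prime factor up to \<open>y\<close>, so every
      divisor \<open>d \<le> y\<close> of \<open>n\<close> is coprime to \<open>b\<close> and
      divides \<open>a\<close>.\<close>
    case False
    have "trunc_conv y (a * b) = trunc_conv y a * \<nu> b"
    proof (rule trunc_conv_mult[OF ab(1-3)])
      fix d assume d: "d dvd a * b" "d \<le> y"
      have "d > 0" using d n ab by (auto intro: Nat.gr0I)
      have "coprime d b"
      proof (rule coprime_if_no_common_prime)
        fix p assume p: "prime p" "p dvd d"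
        show "\<not> p dvd b"
        proof
          assume "p dvd b"
          have "p \<le> y" using dvd_imp_le[OF p(2) \<open>d > 0\<close>] d(2) by linarith
          moreover have "p \<notin> S" using p \<open>p dvd b\<close> prime_dvd_prime_part[of p "- S" n] by (simp add: b_def)
          moreover have "p \<in> prime_factors n"
            using p(1) dvd_mult[OF \<open>p dvd b\<close>, of a] n by (simp add: ab(4) in_prime_factors_iff)
          ultimately show False using False by auto
        qed
      qed
      then show "d dvd a" using d coprime_dvd_mult_left_iff by blast
    qed
    then have "norm (trunc_conv y n) = norm (trunc_conv y a) * norm (\<nu> b)"
      using ab(4) by (simp add: norm_mult)
    then have "norm (trunc_conv y n) - norm (trunc_conv y a) = norm (trunc_conv y a) * (norm (\<nu> b) - 1)"
      by (simp add: algebra_simps)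
    then have "\<bar>norm (trunc_conv y n) - norm (trunc_conv y a)\<bar> =
        norm (trunc_conv y a) * \<bar>norm (\<nu> b) - 1\<bar>"
      by (simp add: abs_mult)
    also have "\<dots> \<le> C * (\<Sum>q | q dvd n \<and> q > Y. deviation q)"
    proof (intro mult_mono aC C0)
      let ?Q = "- S \<inter> prime_factors n"
      have Q: "prime p" "multiplicity p n > 0" "p ^ multiplicity p n > Y" if "p \<in> ?Q" for p
        using that by (auto simp: prime_factors_multiplicity S_def)
      have "\<bar>norm (\<nu> b) - 1\<bar> \<le> B * (\<Sum>p\<in>?Q. \<bar>norm (\<nu> (p ^ multiplicity p n)) - 1\<bar>)"
        unfolding b_def prime_part_def by (rule abs_nu.abs_prod_prime_powers_minus_1_le) auto
      also have "\<dots> = (\<Sum>p\<in>?Q. B * \<bar>norm (\<nu> (p ^ multiplicity p n)) - 1\<bar>)"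
        by (simp add: sum_distrib_left)
      also have "\<dots> \<le> (\<Sum>p\<in>?Q. deviation (p ^ multiplicity p n))"
        by (intro sum_mono deviation_prime_power_ge Q)
      \<comment> \<open>Positive powers of distinct primes are distinct, so the sum over primes
        becomes a sum over divisors \<open>q\<close> of \<open>n\<close>.\<close>
      also have "\<dots> = (\<Sum>q\<in>(\<lambda>p. p ^ multiplicity p n) ` ?Q. deviation q)"
      proof (rule sum.reindex_cong[symmetric, OF _ refl refl])
        show "inj_on (\<lambda>p. p ^ multiplicity p n) ?Q"
        proof (rule inj_onI)
          fix p q assume pq: "p \<in> ?Q" "q \<in> ?Q" "p ^ multiplicity p n = q ^ multiplicity q n"
          have "p dvd q ^ multiplicity q n" using Q(2)[OF pq(1)] by (simp flip: pq(3))
          then have "p dvd q" using Q(1)[OF pq(1)] prime_dvd_power by blast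
          then show "p = q" using Q(1) pq primes_dvd_imp_eq by blast
        qed
      qed
      also have "\<dots> \<le> (\<Sum>q | q dvd n \<and> q > Y. deviation q)"
        using fin Q by (intro sum_mono2) (auto simp: deviation_nonneg multiplicity_dvd)
      finally show "\<bar>norm (\<nu> b) - 1\<bar> \<le> (\<Sum>q | q dvd n \<and> q > Y. deviation q)" .
    qed auto
    finally show ?thesis unfolding a C_def .
  qed
qed

lemma avg_tendsto_norm_if_summable:
  assumes "summable (\<lambda>p. of_bool (prime p) * (\<bar>norm (\<nu> p) - 1\<bar> / real p))"
  shows "\<exists>m. avg_tendsto (\<lambda>n. norm (g n)) m"
proof (rule avg_tendsto_approx)
  fix e :: real assume e: "e > 0"
  have B: "B \<ge> 1" by (rule abs_nu.B_ge_1)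
  have "e / (2 * B) > 0" using e B by simp
  from summable_tail_small[OF summable_f this]
  obtain y where y: "\<And>k. (\<Sum>d\<in>{y<..k}. norm (f d) / real d) \<le> e / (2 * B)" by blast
  define C where "C = B * (\<Sum>d\<le>y. norm (f d))"
  have C0: "C \<ge> 0" using B by (auto simp: C_def intro!: mult_nonneg_nonneg sum_nonneg)
  \<comment> \<open>The cutoff \<open>y\<close> fixes \<open>C\<close>, and only then is
    \<open>Y\<close> chosen. Each error receives \<open>e / 2\<close>; \<open>C + 1\<close> is used
    because \<open>C\<close> may be 0.\<close>
  have "e / (2 * (C + 1)) > 0" using e C0 by simp
  from summable_tail_small[OF summable_deviation[OF assms] this]
  obtain Y0 where Y0: "\<forall>Y\<ge>Y0. \<forall>k. (\<Sum>q\<in>{Y<..k}. deviation q / real q) \<le> e / (2 * (C + 1))" ..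
  define Y where "Y = max y Y0"
  have Y: "Y \<ge> y" "\<And>k. (\<Sum>q\<in>{Y<..k}. deviation q / real q) \<le> e / (2 * (C + 1))"
    using Y0 by (auto simp: Y_def)
  define v where "v n = norm (trunc_conv y (small_part Y n))" for n
  have "avg_tendsto v ((\<Sum>n=1..(fact Y)\<^sup>2. v n) / real ((fact Y)\<^sup>2))"
    by (rule avg_tendsto_periodic) (auto simp: v_def small_part_periodic)
  moreover have "avg_le (\<lambda>n. \<bar>norm (g n) - v n\<bar>) e"
  proof (rule avg_le_mono)
    show "avg_le (\<lambda>n. B * (\<Sum>d | d dvd n \<and> d > y. norm (f d)) + C * (\<Sum>q | q dvd n \<and> q > Y. deviation q))
        (B * (e / (2 * B)) + C * (e / (2 * (C + 1))))"
      using B C0 y Y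
      by (intro avg_le_add avg_le_cmult avg_le_tail_divisors) (auto simp: deviation_nonneg)
    have "C * (e / (2 * (C + 1))) \<le> (C + 1) * (e / (2 * (C + 1)))"
      using C0 e by (intro mult_right_mono) auto
    also have "\<dots> = e / 2" using C0 by (simp add: field_simps)
    finally have "C * (e / (2 * (C + 1))) \<le> e / 2" .
    moreover have "B * (e / (2 * B)) = e / 2" using B by simp
    ultimately show "B * (e / (2 * B)) + C * (e / (2 * (C + 1))) \<le> e" by linarith
    fix n :: nat assume n: "n > 0"
    have "\<bar>norm (g n) - norm (trunc_conv y n)\<bar> \<le> norm (g n - trunc_conv y n)"
      by (rule norm_triangle_ineq3)
    then show "\<bar>norm (g n) - v n\<bar> \<le> B * (\<Sum>d | d dvd n \<and> d > y. norm (f d)) + C * (\<Sum>q | q dvd n \<and> q > Y. deviation q)"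
      using norm_diff_trunc_conv_le[OF n, of y] norm_trunc_conv_small_part[OF n Y(1)]
      unfolding v_def C_def by linarith
  qed
  ultimately show "\<exists>v m. avg_tendsto v m \<and> avg_le (\<lambda>n. \<bar>norm (g n) - v n\<bar>) e" by blast
qed

text \<open>Each dilate of the absolute value of \<nu> has upper mean 0. Finitely many of them
  majorize the truncated convolution, and the divisors above \<open>y\<close> cost at most
  \<open>e\<close>.\<close>

lemma avg_tendsto_norm_if_avg_le_0:
  assumes "avg_le (\<lambda>n. norm (\<nu> n)) 0"
  shows "\<exists>m. avg_tendsto (\<lambda>n. norm (g n)) m"
proof (rule avg_tendsto_approx)
  fix e :: real assume e: "e > 0"
  have B: "B \<ge> 1" by (rule abs_nu.B_ge_1)
  have "e / B > 0" using e B by simp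
  from summable_tail_small[OF summable_f this]
  obtain y where y: "\<And>k. (\<Sum>d\<in>{y<..k}. norm (f d) / real d) \<le> e / B" by blast
  have "avg_le (\<lambda>n. \<bar>norm (g n) - 0\<bar>) e"
  proof (rule avg_le_mono)
    show "avg_le (\<lambda>n. (\<Sum>d\<in>{0<..y}. norm (f d) * dilate d (\<lambda>n. norm (\<nu> n)) n) + B * (\<Sum>d | d dvd n \<and> d > y. norm (f d)))
        ((\<Sum>d\<in>{0<..y}. norm (f d) * (0 / real d)) + B * (e / B))"
      using B y assms
      by (intro avg_le_add avg_le_cmult avg_le_sum avg_le_dilate avg_le_tail_divisors) auto
    show "(\<Sum>d\<in>{0<..y}. norm (f d) * (0 / real d)) + B * (e / B) \<le> e" using B by simp
    fix n :: nat assume n: "n > 0"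
    have "norm (trunc_conv y n) \<le> (\<Sum>d | d dvd n \<and> d \<le> y. norm (f d) * norm (\<nu> (n div d)))"
      unfolding trunc_conv_def by (rule sum_norm_le) (simp add: norm_mult)
    also have "\<dots> = (\<Sum>d\<in>{d \<in> {0<..y}. d dvd n}. norm (f d) * norm (\<nu> (n div d)))"
      using n by (intro sum.cong) (auto intro: Nat.gr0I)
    also have "\<dots> = (\<Sum>d\<in>{0<..y}. if d dvd n then norm (f d) * norm (\<nu> (n div d)) else 0)"
      by (rule sum.inter_filter) simp
    also have "\<dots> = (\<Sum>d\<in>{0<..y}. norm (f d) * dilate d (\<lambda>n. norm (\<nu> n)) n)"
      by (intro sum.cong) (auto simp: dilate_def)
    finally show "\<bar>norm (g n) - 0\<bar> \<le> (\<Sum>d\<in>{0<..y}. norm (f d) * dilate d (\<lambda>n. norm (\<nu> n)) n) + B * (\<Sum>d | d dvd n \<and> d > y. norm (f d))"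
      using norm_diff_trunc_conv_le[OF n, of y] norm_triangle_ineq2[of "g n" "trunc_conv y n"] by simp
  qed
  moreover have "avg_tendsto (\<lambda>_. 0) 0" by (simp add: avg_tendsto_def)
  ultimately show "\<exists>v m. avg_tendsto v m \<and> avg_le (\<lambda>n. \<bar>norm (g n) - v n\<bar>) e" by blast
qed

text \<open>Dichotomy on the series of deficits \<open>(1 - norm (\<nu> p)) / p\<close> over primes
  with \<open>norm (\<nu> p) < 1\<close>: convergence makes the two-sided deviation summable,
  divergence makes the mean of \<open>norm (\<nu> n)\<close> vanish.\<close>

lemma avg_tendsto_norm: "\<exists>m. avg_tendsto (\<lambda>n. norm (g n)) m"
  using abs_nu.summable_deviation avg_tendsto_norm_if_summable
    abs_nu.avg_le_0_if_not_summable avg_tendsto_norm_if_avg_le_0 by blast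

end

section \<open>Positivity of the mean value\<close>

definition rough :: "nat \<Rightarrow> nat set" where
  "rough z = {b. b > 0 \<and> (\<forall>p. prime p \<longrightarrow> p \<le> z \<longrightarrow> \<not> p dvd b)}"

definition smooth :: "nat \<Rightarrow> nat set" where
  "smooth z = {a. a > 0 \<and> (\<forall>p. prime p \<longrightarrow> p dvd a \<longrightarrow> p \<le> z)}"

lemma coprime_smooth_rough: "a \<in> smooth z \<Longrightarrow> b \<in> rough z \<Longrightarrow> coprime a b"
  by (rule coprime_if_no_common_prime) (auto simp: smooth_def rough_def)

lemma smooth_if_le: "0 < a \<Longrightarrow> a \<le> z \<Longrightarrow> a \<in> smooth z"
  unfolding smooth_def by (auto dest: dvd_imp_le)

lemma rough_div: "b \<in> rough z \<Longrightarrow> e dvd b \<Longrightarrow> b div e \<in> rough z"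
  unfolding rough_def by (auto elim!: dvdE)

text \<open>Roughness has period \<open>fact z\<close>, a multiple of every prime up to
  \<open>z\<close>, and 1 is rough, so the average over a period is positive.\<close>

lemma rough_avg_exists: "\<exists>\<phi>>0. avg_tendsto (\<lambda>b. of_bool (b \<in> rough z)) \<phi>"
proof -
  let ?r = "\<lambda>b. of_bool (b \<in> rough z) :: real"
  let ?N = "fact z :: nat"
  have "?r (b + ?N) = ?r b" if "b > 0" for b
  proof -
    have "p dvd b + ?N \<longleftrightarrow> p dvd b" if "prime p" "p \<le> z" for p
    proof -
      have "p dvd ?N" using that prime_ge_1_nat[of p] by (intro dvd_fact) auto
      then show ?thesis by (simp add: dvd_add_left_iff)
    qed
    then show ?thesis using that by (auto simp: rough_def)
  qed
  then have avg: "avg_tendsto ?r ((\<Sum>n=1..?N. ?r n) / real ?N)"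
    by (intro avg_tendsto_periodic) auto
  have "(\<Sum>n=1..?N. ?r n) \<ge> ?r 1"
    by (rule member_le_sum) (auto simp: Suc_le_eq)
  moreover have "1 \<in> rough z" using not_prime_1 by (auto simp: rough_def)
  ultimately have "(\<Sum>n=1..?N. ?r n) / real ?N > 0" by (intro divide_pos_pos) auto
  with avg show ?thesis by blast
qed

text \<open>Every \<open>n\<close> factors in at most one way as smooth times rough, so the sets of multiples
  \<open>a * rough z\<close> with \<open>a \<in> smooth z\<close> are disjoint; no Euler product is needed.\<close>

lemma sum_smooth_reciprocals_le:
  assumes \<phi>: "avg_tendsto (\<lambda>b. of_bool (b \<in> rough z)) \<phi>"
    and A: "finite A" "A \<subseteq> smooth z"
  shows "\<phi> * (\<Sum>a\<in>A. 1 / real a) \<le> 1"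
proof -
  let ?r = "\<lambda>b. of_bool (b \<in> rough z) :: real"
  have "avg_tendsto (\<lambda>n. \<Sum>a\<in>A. dilate a ?r n) (\<Sum>a\<in>A. \<phi> / real a)"
    using A by (intro avg_tendsto_sum avg_tendsto_dilate \<phi>) (auto simp: smooth_def)
  moreover have "avg_le (\<lambda>n. \<Sum>a\<in>A. dilate a ?r n) 1"
  proof (rule avg_le_mono[OF avg_tendsto_imp_le[OF avg_tendsto_1]])
    fix n :: nat assume n: "n > 0"
    \<comment> \<open>A smooth divisor of \<open>n\<close> is coprime to the rough cofactor of
      \<open>a'\<close>, hence divides \<open>a'\<close>; by symmetry the smooth factor is
      unique.\<close>
    have uniq: "a dvd a'" if "a \<in> A" "a' \<in> A" "a dvd n" "a' dvd n" "n div a' \<in> rough z" for a a'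
    proof -
      have "coprime a (n div a')" using that A coprime_smooth_rough by blast
      moreover have "a dvd a' * (n div a')" using that by simp
      ultimately show ?thesis using coprime_dvd_mult_left_iff by blast
    qed
    show "(\<Sum>a\<in>A. dilate a ?r n) \<le> 1"
    proof (cases "\<exists>a\<in>A. a dvd n \<and> n div a \<in> rough z")
      case True
      then obtain a where a: "a \<in> A" "a dvd n" "n div a \<in> rough z" by blast
      have "(\<Sum>a'\<in>A. dilate a' ?r n) = (\<Sum>a'\<in>{a}. dilate a' ?r n)"
      proof (rule sum.mono_neutral_right)
        show "\<forall>a'\<in>A - {a}. dilate a' ?r n = 0"
        proof (rule ballI, rule ccontr)
          fix a' assume a': "a' \<in> A - {a}" "dilate a' ?r n \<noteq> 0"
          then have "a' dvd n" "n div a' \<in> rough z" by (auto simp: dilate_def split: if_splits)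
          with a a' uniq[of a a'] uniq[of a' a] have "a = a'" by (intro dvd_antisym) auto
          with a' show False by simp
        qed
      qed (use a A in auto)
      then show ?thesis by (simp add: dilate_def)
    next
      case False
      then have "(\<Sum>a\<in>A. dilate a ?r n) = 0" by (intro sum.neutral) (auto simp: dilate_def)
      then show ?thesis by simp
    qed
  qed auto
  ultimately have "(\<Sum>a\<in>A. \<phi> / real a) \<le> 1" by (rule avg_tendsto_le)
  then show ?thesis by (simp add: sum_distrib_left)
qed

text \<open>Write \<open>n = a * b\<close> with \<open>a\<close> smooth and \<open>b\<close> rough.
  If \<open>n\<close> is in \<open>X\<close>, so is \<open>b\<close>; hence \<open>X\<close> is
  covered by the multiples by \<open>a\<close> of \<open>X \<inter> rough z\<close>, each of upper
  density at most \<open>\<beta> / a\<close>, and the reciprocals of smooth numbers sum to at most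
  \<open>1 / \<phi>\<close>.\<close>

lemma density_le_rough_density:
  assumes \<phi>: "\<phi> > 0" "avg_tendsto (\<lambda>b. of_bool (b \<in> rough z)) \<phi>"
    and X: "avg_tendsto (\<lambda>n. of_bool (n \<in> X)) \<delta>"
    and \<beta>: "\<beta> \<ge> 0" "avg_le (\<lambda>n. of_bool (n \<in> X \<inter> rough z)) \<beta>"
    and closed: "\<And>a b. 0 < a \<Longrightarrow> 0 < b \<Longrightarrow> coprime a b \<Longrightarrow> a * b \<in> X \<Longrightarrow> b \<in> X"
  shows "\<delta> \<le> \<beta> / \<phi>"
proof (rule field_le_epsilon)
  fix e :: real assume e: "e > 0"
  let ?s = "\<lambda>a. of_bool (a \<in> smooth z) :: real"
  let ?x = "\<lambda>n. of_bool (n \<in> X \<inter> rough z) :: real"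
  have "summable (\<lambda>a. ?s a / real a)"
  proof (rule summableI_nonneg_bounded)
    fix N
    have "(\<Sum>a<N. ?s a / real a) = (\<Sum>a\<in>{..<N} \<inter> smooth z. 1 / real a)"
      by (rule sum.mono_neutral_cong_right) auto
    also have "\<dots> \<le> 1 / \<phi>"
      using sum_smooth_reciprocals_le[OF \<phi>(2), of "{..<N} \<inter> smooth z"] \<phi>(1)
      by (simp add: pos_le_divide_eq mult.commute)
    finally show "(\<Sum>a<N. ?s a / real a) \<le> 1 / \<phi>" .
  qed simp
  from summable_tail_small[OF this e]
  obtain Y where Y: "\<And>k. (\<Sum>a\<in>{Y<..k}. ?s a / real a) \<le> e" by blast
  \<comment> \<open>Only finitely many dilates can be added; integers with smooth part above
    \<open>Y\<close> are counted by a tail of divisors costing \<open>e\<close>.\<close>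
  define A where "A = {..Y} \<inter> smooth z"
  have "avg_le (\<lambda>n. of_bool (n \<in> X)) (\<beta> / \<phi> + e)"
  proof (rule avg_le_mono)
    show "avg_le (\<lambda>n. (\<Sum>a\<in>A. dilate a ?x n) + (\<Sum>a | a dvd n \<and> a > Y. ?s a))
        ((\<Sum>a\<in>A. \<beta> / real a) + e)"
    proof (intro avg_le_add avg_le_sum avg_le_dilate avg_le_tail_divisors \<beta> Y)
      fix a assume "a \<in> A"
      then show "a > 0" by (simp add: A_def smooth_def)
    qed simp
    have "\<beta> * (\<phi> * (\<Sum>a\<in>A. 1 / real a)) \<le> \<beta> * 1"
      using \<beta>(1) by (intro mult_left_mono sum_smooth_reciprocals_le[OF \<phi>(2)]) (auto simp: A_def)
    then have "\<beta> * (\<Sum>a\<in>A. 1 / real a) \<le> \<beta> / \<phi>"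
      using \<phi>(1) by (simp add: pos_le_divide_eq mult_ac)
    then show "(\<Sum>a\<in>A. \<beta> / real a) + e \<le> \<beta> / \<phi> + e"
      by (simp add: sum_distrib_left)
    fix n :: nat assume n: "n > 0"
    define a where "a = prime_part {..z} n"
    define b where "b = prime_part (- {..z}) n"
    have ab: "a > 0" "b > 0" "coprime a b" "a * b = n"
      unfolding a_def b_def
      by (rule prime_part_pos coprime_prime_part_compl prime_part_mult_compl[OF n])+
    have a: "a \<in> smooth z"
      unfolding smooth_def using ab(1) prime_dvd_prime_part[of _ "{..z}" n] by (simp add: a_def)
    have "\<not> p dvd b" if "prime p" "p \<le> z" for p
      using prime_dvd_prime_part[of p "- {..z}" n] that unfolding b_def by auto
    then have b: "b \<in> rough z" using ab(2) by (simp add: rough_def)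
    have nn: "0 \<le> (\<Sum>a\<in>A. dilate a ?x n)" "0 \<le> (\<Sum>a | a dvd n \<and> a > Y. ?s a)"
      by (auto intro!: sum_nonneg simp: dilate_def)
    show "of_bool (n \<in> X) \<le> (\<Sum>a\<in>A. dilate a ?x n) + (\<Sum>a | a dvd n \<and> a > Y. ?s a)"
    proof (cases "n \<in> X")
      case True
      then have bX: "b \<in> X" using closed[of a b] ab by simp
      have "n div a = b" "a dvd n" using ab by auto
      show ?thesis
      proof (cases "a \<le> Y")
        case True
        then have "dilate a ?x n \<le> (\<Sum>a\<in>A. dilate a ?x n)"
          using a by (intro member_le_sum) (auto simp: A_def dilate_def)
        moreover have "dilate a ?x n = 1"
          using bX b \<open>n div a = b\<close> \<open>a dvd n\<close> by (simp add: dilate_def)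
        ultimately show ?thesis using nn \<open>n \<in> X\<close> by simp
      next
        case False
        then have "?s a \<le> (\<Sum>a | a dvd n \<and> a > Y. ?s a)"
          using \<open>a dvd n\<close> n by (intro member_le_sum) auto
        then show ?thesis using nn \<open>n \<in> X\<close> a by simp
      qed
    qed (use nn in simp)
  qed
  with X show "\<delta> \<le> \<beta> / \<phi> + e" by (rule avg_tendsto_le)
qed

section \<open>Lower bound for the mean value on multiples of the least support element\<close>

context dirichlet_factor
begin

text \<open>If \<open>D\<close> divides \<open>d * b\<close>, then \<open>D div gcd D d\<close>
  divides \<open>b\<close>, and the quotient is again rough. This retains the factor \<phi> in the
  error, which must be compared with a main term of order \<phi>.\<close>

lemma avg_le_rough_error:
  assumes \<phi>: "\<phi> > 0" "avg_tendsto (\<lambda>b. of_bool (b \<in> rough z)) \<phi>"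
    and d: "d > 0" and \<tau>: "\<And>k. (\<Sum>D\<in>{z<..k}. norm (f D) / real D) \<le> \<tau>"
  shows "avg_le (\<lambda>b. of_bool (b \<in> rough z) * (\<Sum>D | D dvd d * b \<and> D > z. norm (f D))) (\<phi> * real d * \<tau>)"
proof (rule avg_le_limit)
  fix e :: real assume "e > 0"
  then have "e / real d > 0" using d by simp
  from summable_tail_small[OF summable_f this]
  \<comment> \<open>Divisors above \<open>Y\<close> are estimated without using roughness, so their
    cost lacks the factor \<phi> but is at most \<open>e\<close>.\<close>
  obtain Y where Y: "\<And>k. (\<Sum>D\<in>{Y<..k}. norm (f D) / real D) \<le> e / real d" by blast
  let ?r = "\<lambda>b. of_bool (b \<in> rough z) :: real"
  define q where "q D = D div gcd D d" for D
  have q: "q D > 0" "1 / real (q D) \<le> real d / real D" if "D > 0" for D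
  proof -
    have g: "gcd D d dvd D" "gcd D d \<le> d" "gcd D d > 0" using d by auto
    then show "q D > 0" using that unfolding q_def by (metis dvd_div_eq_0_iff not_gr_zero)
    have "1 / real (q D) = real (gcd D d) / real D" unfolding q_def using g by (simp add: real_of_nat_div)
    then show "1 / real (q D) \<le> real d / real D" using g by (simp add: divide_right_mono)
  qed
  show "avg_le (\<lambda>b. ?r b * (\<Sum>D | D dvd d * b \<and> D > z. norm (f D))) (\<phi> * real d * \<tau> + e)"
  proof (rule avg_le_mono)
    show "avg_le (\<lambda>b. (\<Sum>D\<in>{z<..Y}. norm (f D) * dilate (q D) ?r b) + (\<Sum>D | D dvd d * b \<and> D > Y. norm (f D)))
       ((\<Sum>D\<in>{z<..Y}. norm (f D) * (\<phi> / real (q D))) + real d * (e / real d))"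
      using \<phi> Y d
      by (intro avg_le_add avg_le_sum avg_le_cmult avg_le_dilate avg_tendsto_imp_le[OF \<phi>(2)]
          avg_le_multiples[where u = "\<lambda>n. \<Sum>D | D dvd n \<and> D > Y. norm (f D)"] avg_le_tail_divisors q)
         (auto intro: sum_nonneg)
    have "(\<Sum>D\<in>{z<..Y}. norm (f D) * (\<phi> / real (q D))) \<le> (\<Sum>D\<in>{z<..Y}. (\<phi> * real d) * (norm (f D) / real D))"
    proof (rule sum_mono)
      fix D assume "D \<in> {z<..Y}"
      then have "D > 0" by auto
      have "norm (f D) * (\<phi> * (1 / real (q D))) \<le> norm (f D) * (\<phi> * (real d / real D))"
        using q(2)[OF \<open>D > 0\<close>] \<phi>(1) by (intro mult_left_mono) auto
      then show "norm (f D) * (\<phi> / real (q D)) \<le> (\<phi> * real d) * (norm (f D) / real D)"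
        by (simp add: mult_ac)
    qed
    also have "\<dots> \<le> (\<phi> * real d) * \<tau>"
      unfolding sum_distrib_left[symmetric] using \<phi>(1) \<tau> by (intro mult_left_mono) auto
    finally show "(\<Sum>D\<in>{z<..Y}. norm (f D) * (\<phi> / real (q D))) + real d * (e / real d) \<le> \<phi> * real d * \<tau> + e"
      using d by simp
    fix b :: nat assume b: "b > 0"
    have nn: "0 \<le> (\<Sum>D\<in>{z<..Y}. norm (f D) * dilate (q D) ?r b)" "0 \<le> (\<Sum>D | D dvd d * b \<and> D > Y. norm (f D))"
      by (auto intro!: sum_nonneg simp: dilate_def)
    show "?r b * (\<Sum>D | D dvd d * b \<and> D > z. norm (f D)) \<le>
        (\<Sum>D\<in>{z<..Y}. norm (f D) * dilate (q D) ?r b) + (\<Sum>D | D dvd d * b \<and> D > Y. norm (f D))"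
    proof (cases "b \<in> rough z")
      case True
      have fin: "finite {D. D dvd d * b \<and> D > Y}" using b d by simp
      have "(\<Sum>D | D dvd d * b \<and> D > z. norm (f D)) \<le>
          (\<Sum>D\<in>{D\<in>{z<..Y}. D dvd d * b} \<union> {D. D dvd d * b \<and> D > Y}. norm (f D))"
        using fin by (intro sum_mono2) auto
      also have "\<dots> = (\<Sum>D\<in>{D\<in>{z<..Y}. D dvd d * b}. norm (f D)) + (\<Sum>D | D dvd d * b \<and> D > Y. norm (f D))"
        using fin by (intro sum.union_disjoint) auto
      also have "(\<Sum>D\<in>{D\<in>{z<..Y}. D dvd d * b}. norm (f D)) = (\<Sum>D\<in>{z<..Y}. if D dvd d * b then norm (f D) else 0)"
        by (rule sum.inter_filter) simp
      also have "\<dots> \<le> (\<Sum>D\<in>{z<..Y}. norm (f D) * dilate (q D) ?r b)"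
      proof (rule sum_mono)
        fix D assume D: "D \<in> {z<..Y}"
        show "(if D dvd d * b then norm (f D) else 0) \<le> norm (f D) * dilate (q D) ?r b"
        proof (cases "D dvd d * b")
          case DVD: True
          \<comment> \<open>Cancelling the gcd leaves \<open>q D\<close> coprime to the remaining
            part of \<open>d\<close>, so it must divide \<open>b\<close>.\<close>
          have g: "gcd D d > 0" using d by simp
          have "coprime (q D) (d div gcd D d)"
            unfolding q_def using d by (intro div_gcd_coprime) auto
          moreover have "q D dvd (d div gcd D d) * b"
          proof -
            have "gcd D d * q D dvd gcd D d * ((d div gcd D d) * b)"
              using DVD by (simp add: q_def mult.assoc[symmetric])
            then show ?thesis using d by simp
          qed
          ultimately have "q D dvd b" using coprime_dvd_mult_right_iff by blast
          then show ?thesis using rough_div[OF True] by (simp add: dilate_def)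
        qed (auto simp: dilate_def)
      qed
      finally show ?thesis using True by simp
    qed (use nn in simp)
  qed
qed

text \<open>If \<open>m \<le> 0\<close>, then \<open>norm (g (d * b))\<close> has upper mean at most
  0 in \<open>b\<close>, and the divisors above \<open>z\<close> alone would have to account for the
  main term.\<close>

lemma avg_norm_pos:
  assumes m: "avg_tendsto (\<lambda>n. norm (g n)) m"
    and \<delta>: "\<delta> > 0" "avg_tendsto (\<lambda>n. of_bool (n \<in> arith_supp \<nu>)) \<delta>"
    and c: "c > 0" "\<And>n. n \<in> arith_supp \<nu> \<Longrightarrow> norm (\<nu> n) \<ge> c"
    and f: "\<exists>n>0. f n \<noteq> 0"
  shows "m > 0"
proof (rule ccontr)
  assume "\<not> m > 0"
  define d where "d = (LEAST n. n > 0 \<and> f n \<noteq> 0)"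
  have d: "d > 0" "f d \<noteq> 0" using LeastI_ex[OF f] by (auto simp: d_def)
  have fd: "f n = 0" if "0 < n" "n < d" for n
    using that not_less_Least[of n "\<lambda>n. n > 0 \<and> f n \<noteq> 0"] by (auto simp: d_def)
  have B: "B \<ge> 1" by (rule abs_nu.B_ge_1)
  define K where "K = c * norm (f d)"
  have K: "K > 0" using c d by (simp add: K_def)
  \<comment> \<open>Chosen so that the resulting bound on the density of the support is exactly
    \<open>\<delta> / 2\<close>.\<close>
  define \<tau> where "\<tau> = \<delta> * K / (2 * B * real d)"
  have "\<tau> > 0" using \<delta> K B d by (simp add: \<tau>_def)
  from summable_tail_small[OF summable_f this]
  obtain z0 where z0: "\<forall>z\<ge>z0. \<forall>k. (\<Sum>D\<in>{z<..k}. norm (f D) / real D) \<le> \<tau>" ..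
  \<comment> \<open>With \<open>z \<ge> d\<close>, the number \<open>d\<close> is smooth, hence
    coprime to every rough \<open>b\<close>, and the term \<open>D = d\<close> survives the
    truncation.\<close>
  define z where "z = max d z0"
  have z: "z \<ge> d" "\<And>k. (\<Sum>D\<in>{z<..k}. norm (f D) / real D) \<le> \<tau>"
    using z0 by (auto simp: z_def)
  obtain \<phi> where \<phi>: "\<phi> > 0" "avg_tendsto (\<lambda>b. of_bool (b \<in> rough z)) \<phi>"
    using rough_avg_exists by blast
  \<comment> \<open>Minimality of \<open>d\<close> removes all proper divisors, leaving
    \<open>f d * \<nu> 1\<close>.\<close>
  have "trunc_conv z d = (\<Sum>D\<in>{d}. f D * \<nu> (d div D))"
    unfolding trunc_conv_def
  proof (rule sum.mono_neutral_right)
    show "\<forall>D\<in>{D. D dvd d \<and> D \<le> z} - {d}. f D * \<nu> (d div D) = 0"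
    proof
      fix D assume "D \<in> {D. D dvd d \<and> D \<le> z} - {d}"
      then have "0 < D" "D < d" using d dvd_imp_le[of D d] by (auto intro: Nat.gr0I)
      then show "f D * \<nu> (d div D) = 0" using fd by simp
    qed
  qed (use d z in auto)
  then have tr: "trunc_conv z d = f d" using d at_1 by simp
  have avg: "avg_le (\<lambda>b. of_bool (b \<in> arith_supp \<nu> \<inter> rough z)) ((1 / K) * (B * (\<phi> * real d * \<tau>)))"
  proof (rule avg_le_mono)
    have "avg_le (\<lambda>n. norm (g n)) 0"
      using avg_le_mono[OF avg_tendsto_imp_le[OF m]] \<open>\<not> m > 0\<close> by auto
    then have "avg_le (\<lambda>b. norm (g (d * b))) (real d * 0)"
      using d by (intro avg_le_multiples[where u = "\<lambda>n. norm (g n)"]) auto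
    then show "avg_le (\<lambda>b. (1 / K) * (norm (g (d * b)) + B * (of_bool (b \<in> rough z) * (\<Sum>D | D dvd d * b \<and> D > z. norm (f D)))))
       ((1 / K) * (real d * 0 + B * (\<phi> * real d * \<tau>)))"
      using K B by (intro avg_le_cmult avg_le_add avg_le_rough_error \<phi> d z) auto
    fix b :: nat assume b: "b > 0"
    let ?E = "\<Sum>D | D dvd d * b \<and> D > z. norm (f D)"
    have E: "?E \<ge> 0" by (intro sum_nonneg) auto
    show "of_bool (b \<in> arith_supp \<nu> \<inter> rough z) \<le> (1 / K) * (norm (g (d * b)) + B * (of_bool (b \<in> rough z) * ?E))"
    proof (cases "b \<in> arith_supp \<nu> \<inter> rough z")
      case True
      have "trunc_conv z (d * b) = trunc_conv z d * \<nu> b"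
      proof (rule trunc_conv_mult[OF d(1) b])
        show "coprime d b" using True d z by (intro coprime_smooth_rough[of _ z] smooth_if_le) auto
        fix D assume D: "D dvd d * b" "D \<le> z"
        then have "D > 0" using d b by (auto intro: Nat.gr0I)
        then have "coprime D b" using True D by (intro coprime_smooth_rough[of _ z] smooth_if_le) auto
        then show "D dvd d" using D coprime_dvd_mult_left_iff by blast
      qed
      then have "norm (trunc_conv z (d * b)) = norm (f d) * norm (\<nu> b)" by (simp add: tr norm_mult)
      also have "\<dots> \<ge> norm (f d) * c" using True c by (intro mult_left_mono) auto
      finally have "K \<le> norm (trunc_conv z (d * b))" by (simp add: K_def mult.commute)
      also have "\<dots> \<le> norm (g (d * b)) + norm (g (d * b) - trunc_conv z (d * b))"
        by (metis norm_minus_commute norm_triangle_sub)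
      also have "\<dots> \<le> norm (g (d * b)) + B * ?E"
        using norm_diff_trunc_conv_le[of "d * b" z] d b by simp
      finally show ?thesis using K True by (simp add: field_simps)
    next
      case False
      have "0 \<le> (1 / K) * (norm (g (d * b)) + B * (of_bool (b \<in> rough z) * ?E))"
        using K B E by (intro mult_nonneg_nonneg add_nonneg_nonneg) auto
      moreover have "of_bool (b \<in> arith_supp \<nu> \<inter> rough z) = (0 :: real)" using False by simp
      ultimately show ?thesis by linarith
    qed
  qed simp
  \<comment> \<open>The support of \<nu> contains the coprime factors of its elements, so its
    density among rough numbers controls \<delta>; the factor \<phi> cancels.\<close>
  have "\<delta> \<le> ((1 / K) * (B * (\<phi> * real d * \<tau>))) / \<phi>"
  proof (rule density_le_rough_density[OF \<phi> \<delta>(2) _ avg])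
    show "0 \<le> (1 / K) * (B * (\<phi> * real d * \<tau>))" using K B \<phi> d \<open>\<tau> > 0\<close> by simp
    fix a b :: nat assume "0 < a" "0 < b" "coprime a b" "a * b \<in> arith_supp \<nu>"
    then show "b \<in> arith_supp \<nu>" using mult[of a b] by (auto simp: arith_supp_def)
  qed
  also have "\<dots> = \<delta> / 2" using K B \<phi> d by (simp add: \<tau>_def)
  finally show False using \<delta> by simp
qed

end

theorem theorem1p6:
  fixes \<nu> f g :: "nat \<Rightarrow> complex"
  assumes "arith_bounded \<nu>"
    and "arith_multiplicative \<nu>"
    and "\<exists>\<delta>>0. has_asymp_density (arith_supp \<nu>) \<delta>"
    and "\<forall>n>0. g n = dirichlet_conv f \<nu> n"
    and "summable (\<lambda>n. norm (f (Suc n)) / real (Suc n))"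
  shows "\<exists>m::real. has_mean_value (\<lambda>n. norm (g n)) m \<and>
           ((\<exists>n>0. f n \<noteq> 0) \<and> (INF n\<in>arith_supp \<nu>. norm (\<nu> n)) > 0 \<longrightarrow> m > 0)"
proof -
  from assms(1) obtain B where B: "\<And>n. n > 0 \<Longrightarrow> norm (\<nu> n) \<le> B"
    by (auto simp: arith_bounded_def)
  have "summable (\<lambda>n. norm (f n) / real n)"
    using assms(5) summable_Suc_iff[of "\<lambda>n. norm (f n) / real n"] by simp
  then interpret dirichlet_factor \<nu> f g B
    by unfold_locales (use assms(2,4) B in auto)
  obtain m where m: "avg_tendsto (\<lambda>n. norm (g n)) m" using avg_tendsto_norm by blast
  obtain \<delta> where \<delta>: "\<delta> > 0" "avg_tendsto (\<lambda>n. of_bool (n \<in> arith_supp \<nu>)) \<delta>"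
    using assms(3) avg_tendsto_if_has_asymp_density by blast
  have "m > 0" if "\<exists>n>0. f n \<noteq> 0" "(INF n\<in>arith_supp \<nu>. norm (\<nu> n)) > 0"
  \<comment> \<open>The infimum itself serves as the constant \<open>c\<close>; it is a lower bound
    because norms are bounded below by 0.\<close>
  proof (rule avg_norm_pos[OF m \<delta> that(2) _ that(1)])
    fix n assume "n \<in> arith_supp \<nu>"
    then show "norm (\<nu> n) \<ge> (INF n\<in>arith_supp \<nu>. norm (\<nu> n))"
      by (intro cINF_lower bdd_belowI[of _ 0]) auto
  qed
  with has_mean_value_if_avg_tendsto[OF m] show ?thesis by blast
qed

end
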